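(* Let $G=(V_0,V_1,E)$ be a connected plane bipartite graph with non-empty color classes. The arborescence number of its (directed) planar dual $G^*$ agrees with the number of hypertrees in the hypergraphs $\mathscr G_0=(V_1,V_0)$ and $\mathscr G_1=(V_0,V_1)$ induced by $G$. That is, $$\rho(G^* )=|Q_{\mathscr G_0}\cap\mathbf Z^{V_0}|=|Q_{\mathscr G_1}\cap\mathbf Z^{V_1}|.$$
   Context: A plane bipartite graph $G=(V_0,V_1,E)$ is a finite bipartite graph with color classes $V_0,V_1$ and edge set $E$ (multiple edges allowed) together with an embedding in the sphere $S^2$. It induces two hypergraphs: $\mathscr G_0=(V_1,V_0)$, with vertex set $V_1$ and hyperedges indexed by $V_0$ (each element of $V_0$ is regarded as the set of its neighbors in $V_1$), and $\mathscr G_1=(V_0,V_1)$, with vertex set $V_0$ and hyperedges indexed by $V_1$. A hypertree in $\mathscr G_0$ is a function $f\colon V_0\to\mathbf N=\{0,1,2,\ldots\}$ such that some spanning tree of $G$ has degree $f(x)+1$ at each $x\in V_0$; similarly for $\mathscr G_1$ with $V_1$ in place of $V_0$. $Q_{\mathscr G_i}\subset\mathbf R^{V_i}$ is the hypertree polytope (the convex hull of the hypertrees), whose integer points $Q_{\mathscr G_i}\cap\mathbf Z^{V_i}$ are exactly the hypertrees of $\mathscr G_i$. The planar dual $G^*$ is the classical one: its vertices are the regions of $G$ and its edges are in one-to-one correspondence with the edges of $G$, each crossing its dual edge once. $G^*$ is directed so that every dual edge runs in the positive (counterclockwise) sense around the endpoint in $V_0$ of the edge it crosses and, consistently, in the negative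 sense around the endpoint in $V_1$ (or the opposite of this orientation for all edges). At each vertex of $G^*$ the in-degree equals the out-degree, i.e. $G^*$ is balanced. A spanning arborescence of a directed graph $D$ with root $r$ is a spanning tree of $D$ in which the unique path from $r$ to any other vertex is oriented toward that vertex. By a theorem of Tutte, for a finite balanced directed graph the number of spanning arborescences does not depend on the root (and is the same as the number of spanning trees oriented toward the root); this number is the arborescence number $\rho(D)$. *)

theory Defs
  imports
    "HOL-Analysis.Analysis"
    "HOL-Complex_Analysis.Winding_Numbers"
    "Graph_Theory.Digraph_Component"
    "Graph_Theory.Arc_Walk"
begin

section \<open>Multigraphs, spanning trees and arborescences\<close>

text \<open>
  An undirected multigraph is a \<^typ>\<open>('v,'e) pre_digraph\<close> whose arc directions are ignored.
  The library's \<open>forest\<close> and \<open>tree\<close> only look at directed cycles, and its \<open>mk_symmetric\<close> merges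
  parallel arcs, so undirected walks are rendered as walks in the digraph below, in which an
  arc \<open>(e, True)\<close> traverses \<open>e\<close> forwards and \<open>(e, False)\<close> traverses it backwards.
\<close>

definition both_ways :: "('v,'e) pre_digraph \<Rightarrow> ('v, 'e \<times> bool) pre_digraph" where
  "both_ways G = \<lparr> verts = verts G, arcs = arcs G \<times> UNIV,
     tail = (\<lambda>(e, fwd). if fwd then tail G e else head G e),
     head = (\<lambda>(e, fwd). if fwd then head G e else tail G e) \<rparr>"

text \<open>
  \<open>distinct (map fst p)\<close> excludes going along an edge and straight back; two parallel edges
  still form a cycle, and so does a loop.
\<close>

definition undirected_cycle :: "('v,'e) pre_digraph \<Rightarrow> ('e \<times> bool) list \<Rightarrow> bool" where
  "undirected_cycle G p \<longleftrightarrow> pre_digraph.cycle (both_ways G) p \<and> distinct (map fst p)"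

text \<open>A spanning tree is identified with its set of edges.\<close>

definition is_spanning_tree :: "('v,'e) pre_digraph \<Rightarrow> 'e set \<Rightarrow> bool" where
  "is_spanning_tree G T \<longleftrightarrow> T \<subseteq> arcs G
     \<and> Digraph_Component.connected (G\<lparr>arcs := T\<rparr>)
     \<and> (\<nexists>p. undirected_cycle (G\<lparr>arcs := T\<rparr>) p)"

definition is_spanning_arborescence :: "('v,'e) pre_digraph \<Rightarrow> 'v \<Rightarrow> 'e set \<Rightarrow> bool" where
  "is_spanning_arborescence D r A \<longleftrightarrow> is_spanning_tree D A
     \<and> (\<forall>v \<in> verts D. \<forall>p. pre_digraph.apath (both_ways (D\<lparr>arcs := A\<rparr>)) r p v
          \<longrightarrow> (\<forall>(e, fwd) \<in> set p. fwd))"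

text \<open>The common number of spanning arborescences for all choices of the root.\<close>

definition arborescence_number :: "('v,'e) pre_digraph \<Rightarrow> nat" where
  "arborescence_number D = (THE n. \<forall>r \<in> verts D. card {A. is_spanning_arborescence D r A} = n)"


section \<open>Bipartite graphs and hypertrees\<close>

text \<open>
  The color classes are the types \<open>'a\<close> (for \<open>V\<^sub>0\<close>) and \<open>'b\<close> (for \<open>V\<^sub>1\<close>), the edges are the
  elements of \<open>'e\<close>; parallel edges are allowed.  All three types will be finite.
\<close>

record ('a,'b,'e) bigraph =
  end0 :: "'e \<Rightarrow> 'a"
  end1 :: "'e \<Rightarrow> 'b"

definition graph_of :: "('a,'b,'e) bigraph \<Rightarrow> ('a + 'b, 'e) pre_digraph" where
  "graph_of G = \<lparr> verts = UNIV, arcs = UNIV,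
     tail = (\<lambda>e. Inl (end0 G e)), head = (\<lambda>e. Inr (end1 G e)) \<rparr>"

text \<open>
  The argument \<open>c\<close> is the endpoint map to the color class that indexes the hyperedges:
  \<open>c = end0 G\<close> gives the hypertrees of the hypergraph \<open>(V\<^sub>1, V\<^sub>0)\<close>, and \<open>c = end1 G\<close> those of
  \<open>(V\<^sub>0, V\<^sub>1)\<close>.
\<close>

definition hypertree :: "('a,'b,'e) bigraph \<Rightarrow> ('e \<Rightarrow> 'c) \<Rightarrow> ('c \<Rightarrow> nat) \<Rightarrow> bool" where
  "hypertree G c f \<longleftrightarrow>
     (\<exists>T. is_spanning_tree (graph_of G) T \<and> (\<forall>x. card {e \<in> T. c e = x} = f x + 1))"

definition hypertree_polytope ::
  "('a,'b,'e) bigraph \<Rightarrow> ('e \<Rightarrow> 'c) \<Rightarrow> (real ^ 'c::finite) set" where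
  "hypertree_polytope G c = convex hull {(\<chi> x. real (f x)) | f. hypertree G c f}"

definition integer_points :: "(real ^ 'c::finite) set" where
  "integer_points = {z. \<forall>x. z $ x \<in> \<int>}"


section \<open>Embeddings in the sphere and the directed planar dual\<close>

abbreviation S2 :: "(real ^ 3) set" where
  "S2 \<equiv> sphere 0 1"

definition drawing :: "('a + 'b \<Rightarrow> real ^ 3) \<Rightarrow> ('e \<Rightarrow> real \<Rightarrow> real ^ 3) \<Rightarrow> (real ^ 3) set" where
  "drawing pos \<gamma> = range pos \<union> (\<Union>e. path_image (\<gamma> e))"

text \<open>\<open>\<gamma> e\<close> is the arc that represents the edge \<open>e\<close>, parametrized from \<open>V\<^sub>0\<close> to \<open>V\<^sub>1\<close>.\<close>

definition sphere_embedding ::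
  "('a,'b,'e) bigraph \<Rightarrow> ('a + 'b \<Rightarrow> real ^ 3) \<Rightarrow> ('e \<Rightarrow> real \<Rightarrow> real ^ 3) \<Rightarrow> bool" where
  "sphere_embedding G pos \<gamma> \<longleftrightarrow>
     inj pos \<and> drawing pos \<gamma> \<subseteq> S2 \<and>
     (\<forall>e. arc (\<gamma> e) \<and> pathstart (\<gamma> e) = pos (Inl (end0 G e))
        \<and> pathfinish (\<gamma> e) = pos (Inr (end1 G e))
        \<and> \<gamma> e ` {0<..<1} \<inter> range pos = {}) \<and>
     (\<forall>e e'. e \<noteq> e' \<longrightarrow> \<gamma> e ` {0<..<1} \<inter> \<gamma> e' ` {0<..<1} = {})"

definition regions :: "('a + 'b \<Rightarrow> real ^ 3) \<Rightarrow> ('e \<Rightarrow> real \<Rightarrow> real ^ 3) \<Rightarrow> (real ^ 3) set set" where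
  "regions pos \<gamma> = components (S2 - drawing pos \<gamma>)"

text \<open>
  Let \<open>h\<close> be a chart that identifies the sphere without the point \<open>p\<close> with the complex plane.
  The predicate below says that a (piece of a) dual edge \<open>\<delta>\<close> runs from the region \<open>R\<close> to the
  region \<open>R'\<close>, crosses \<open>\<gamma> e\<close> once and is otherwise disjoint from the graph, and that it runs
  in the positive sense, as seen in \<open>h\<close>, around the starting point of \<open>\<gamma> e\<close>, i.e. around the
  endpoint of \<open>e\<close> in \<open>V\<^sub>0\<close>: it can be closed up by a path \<open>\<eta>\<close> off the edge \<open>\<gamma> e\<close> so that the
  resulting loop winds once counterclockwise around that endpoint and does not wind around the
  other one.  The difference of these two winding numbers is the same for all \<open>\<eta>\<close>, as the
  complement of an arc in the sphere is simply connected; adding to \<open>\<eta>\<close> a loop around all of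
  \<open>\<gamma> e\<close> shifts both numbers, so \<open>(1, 0)\<close> can also be turned into \<open>(0, -1)\<close>, which is the
  negative sense around the endpoint in \<open>V\<^sub>1\<close>.  Regions enter as point sets, so \<open>R = R'\<close> is
  possible (for a bridge \<open>e\<close>).
\<close>

definition crosses_positively ::
  "(real ^ 3 \<Rightarrow> complex) \<Rightarrow> real ^ 3 \<Rightarrow> (real \<Rightarrow> real ^ 3) \<Rightarrow> (real ^ 3) set \<Rightarrow> (real ^ 3) set \<Rightarrow> bool"
where
  "crosses_positively h p g R R' \<longleftrightarrow>
     (\<exists>\<delta> \<eta> t. path \<delta> \<and> path_image \<delta> \<subseteq> S2 - {p} \<and> 0 < t \<and> t < 1
        \<and> \<delta> ` {0..<t} \<subseteq> R \<and> \<delta> t \<in> g ` {0<..<1} \<and> \<delta> ` {t<..1} \<subseteq> R'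
        \<and> path \<eta> \<and> path_image \<eta> \<subseteq> S2 - {p} - path_image g
        \<and> pathstart \<eta> = pathfinish \<delta> \<and> pathfinish \<eta> = pathstart \<delta>
        \<and> winding_number (h \<circ> (\<delta> +++ \<eta>)) (h (pathstart g)) = 1
        \<and> winding_number (h \<circ> (\<delta> +++ \<eta>)) (h (pathfinish g)) = 0)"

text \<open>
  The chart \<open>h\<close> is an arbitrary homeomorphism, so it may induce either orientation of the sphere.
  This accounts for the two allowed orientations of the dual (all edges reversed at once).
\<close>

definition directed_planar_dual ::
  "('a + 'b \<Rightarrow> real ^ 3) \<Rightarrow> ('e \<Rightarrow> real \<Rightarrow> real ^ 3) \<Rightarrow> ((real ^ 3) set, 'e) pre_digraph \<Rightarrow> bool" where
  "directed_planar_dual pos \<gamma> D \<longleftrightarrow>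
     verts D = regions pos \<gamma> \<and> arcs D = UNIV
     \<and> tail D ` UNIV \<subseteq> regions pos \<gamma> \<and> head D ` UNIV \<subseteq> regions pos \<gamma>
     \<and> (\<exists>p h k. p \<in> S2 - drawing pos \<gamma> \<and> homeomorphism (S2 - {p}) (UNIV :: complex set) h k
          \<and> (\<forall>e. crosses_positively h p (\<gamma> e) (tail D e) (head D e)))"

end

theory Submission
  imports Defs
begin

text \<open>
  For a real cycle \<open>c\<close> of the drawn graph, the weighted sum of the winding numbers of its edges is a
  function on the regions whose differences along the dual edges are given by \<open>c\<close>.  Together with
  Euler's upper bound for the number of regions, which follows from Janiszewski's theorem and the Jordan
  curve theorem by adding one edge at a time, this makes the complements of the spanning trees of the graph
  exactly the spanning trees of the dual.

  Fix a root region.  The degrees at one color class of the complement \<open>T\<close> of a spanning arborescence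
  determine \<open>T\<close>: if two such trees \<open>T\<close>, \<open>T'\<close> have the same degrees, a directed cycle formed by \<open>T\<close> in one
  direction and \<open>T'\<close> in the other is a dual cut that one of the two arborescences cannot cross.  Conversely,
  every hypertree is realized by such a complement, since cycles of a bipartite graph alternate: a dual arc
  pointing towards the root can be exchanged within its fundamental cut for one pointing away, without changing
  the degrees.  This also gives the independence of the root.

  The integer points of the hypertree polytope are hypertrees because, by Hall's theorem, hypertrees are
  characterized by linear inequalities.

  Connectivity and acyclicity are expressed by cuts: \<open>T\<close> spans if no nontrivial vertex set is without
  crossing edges from \<open>T\<close>, and it is acyclic if each of its edges is the only crossing edge of some set.
\<close>

section \<open>Winding numbers of disjoint paths\<close>

text \<open>The dual is given only through \<open>crosses_positively\<close>: its vertices are point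
  sets, and no face boundary or rotation at a vertex is available. Hence the topology enters through
  just two facts, collected in the locale \<open>planar_dual\<close>. Potentials of cycles give cuts
  of the dual, so complements of spanning sets are acyclic there. That such a complement also
  connects all regions is not shown geometrically but by a count. An upper bound for the number of
  regions is enough for it, since acyclicity supplies the matching lower bound. Coefficients are
  real and not modulo 2 because signs carry the direction of the dual arcs: the sign of a cycle at
  an edge tells in which direction its dual arc crosses the corresponding cut. In a bipartite graph
  the coefficients of a cycle at each vertex sum to zero, and this is the link between degrees and
  directions.\<close>

lemma winding_number_eq_log_increment:
  assumes f: "path f" and q: "path q" and e: "\<And>t. t \<in> {0..1} \<Longrightarrow> f t - z = exp (q t)"
  shows "winding_number f z = (q 1 - q 0) / (2 * of_real pi * \<i>)"
proof -
  have "winding_number f z = winding_number (\<lambda>w. f w - z) 0"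
    by (rule winding_number_offset)
  also have "\<dots> = winding_number (exp \<circ> q) 0"
  proof (rule winding_number_homotopic_paths, rule homotopic_paths_eq)
    show "path (\<lambda>w. f w - z)" using f by (auto simp: path_def intro!: continuous_intros)
    show "path_image (\<lambda>w. f w - z) \<subseteq> - {0}"
      using e by (auto simp: path_image_def)
  qed (use e in auto)
  also have "\<dots> = (q 1 - q 0) / (2 * of_real pi * \<i>)"
    using winding_number_compose_exp[OF q] by (simp add: pathfinish_def pathstart_def)
  finally show ?thesis .
qed

text \<open>Both sides are, up to \<open>2\<pi>\<i>\<close>, increments of one logarithm of \<open>f s - g t\<close> on the unit square
  along its boundary.\<close>
lemma winding_number_disjoint_paths:
  assumes f: "path f" and g: "path g" and disj: "path_image f \<inter> path_image g = {}"
  shows "winding_number f (pathfinish g) - winding_number f (pathstart g)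
       = winding_number g (pathfinish f) - winding_number g (pathstart f)"
proof -
  let ?S = "{0..1::real} \<times> {0..1::real}"
  let ?F = "\<lambda>z. f (fst z) - g (snd z)"
  have cF: "continuous_on ?S ?F"
    by (intro continuous_on_diff continuous_on_compose2[OF f[unfolded path_def] continuous_on_fst]
        continuous_on_compose2[OF g[unfolded path_def] continuous_on_snd] continuous_on_id) auto
  have nz: "?F z \<noteq> 0" if "z \<in> ?S" for z
    using that disj by (auto simp: path_image_def)
  have "contractible ?S"
    by (intro convex_imp_contractible convex_Times) auto
  then obtain L where L: "continuous_on ?S L" and FL: "\<And>z. z \<in> ?S \<Longrightarrow> ?F z = exp (L z)"
    by (rule continuous_logarithm_on_contractible[OF cF _ nz]) auto
  have pf: "path (\<lambda>s. L (s, c))" if "c \<in> {0..1}" for c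
    unfolding path_def by (intro continuous_on_compose2[OF L] continuous_intros) (use that in auto)
  \<comment> \<open>\<open>g t - f c\<close> is the negative of \<open>f c - g t\<close>, so its
    logarithm is shifted by \<i> times pi. The shift drops out of the increment.\<close>
  have pg: "path (\<lambda>t. L (c, t) + \<i> * of_real pi)" if "c \<in> {0..1}" for c
    unfolding path_def by (intro continuous_intros continuous_on_compose2[OF L]) (use that in auto)
  have wf: "winding_number f (g c) = (L (1, c) - L (0, c)) / (2 * of_real pi * \<i>)" if "c \<in> {0..1}" for c
    by (rule winding_number_eq_log_increment[OF f pf]) (use FL that in auto)
  have wg: "winding_number g (f c) = (L (c, 1) - L (c, 0)) / (2 * of_real pi * \<i>)" if "c \<in> {0..1}" for c
  proof -
    have e: "g t - f c = exp (L (c, t) + \<i> * of_real pi)" if "t \<in> {0..1}" for t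
    proof -
      have "f c - g t = exp (L (c, t))" using FL[of "(c,t)"] that \<open>c \<in> {0..1}\<close> by auto
      then have "g t - f c = - exp (L (c, t))" by (metis minus_diff_eq)
      moreover have "exp (L (c, t) + \<i> * of_real pi) = - exp (L (c, t))" by (simp add: exp_add)
      ultimately show ?thesis by simp
    qed
    show ?thesis
      using winding_number_eq_log_increment[OF g pg[OF that] e] by (simp only: add_diff_cancel_right)
  qed
  have 0: "(0::real) \<in> {0..1}" and 1: "(1::real) \<in> {0..1}" by simp_all
  show ?thesis
    unfolding pathstart_def pathfinish_def wf[OF 0] wf[OF 1] wg[OF 0] wg[OF 1] diff_divide_distrib[symmetric]
    by (intro arg_cong2[where f = "(/)"] refl) (simp only: algebra_simps)
qed

section \<open>Adding an arc to a plane drawing\<close>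

lemma connected_componentI:
  "topological_space_class.connected T \<Longrightarrow> T \<subseteq> S \<Longrightarrow> x \<in> T \<Longrightarrow> y \<in> T \<Longrightarrow> connected_component S x y"
  unfolding connected_component_def by blast

text \<open>Any label that separates the components bounds their number. It may vary within a
  component, as only its value at one chosen point of each component is used.\<close>

lemma card_components_le:
  assumes F: "finite F" and \<phi>: "\<And>x. x \<in> S \<Longrightarrow> \<phi> x \<in> F"
    and sep: "\<And>x y. x \<in> S \<Longrightarrow> y \<in> S \<Longrightarrow> \<phi> x = \<phi> y \<Longrightarrow> connected_component S x y"
  shows "finite (components S)" "card (components S) \<le> card F"
proof -
  define \<psi> where "\<psi> C = \<phi> (SOME x. x \<in> C)" for C
  have some: "(SOME x. x \<in> C) \<in> C" if "C \<in> components S" for C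
    using in_components_nonempty[OF that] by (simp add: some_in_eq)
  have inj: "inj_on \<psi> (components S)"
  proof (rule inj_onI)
    fix C C' assume C: "C \<in> components S" and C': "C' \<in> components S" and eq: "\<psi> C = \<psi> C'"
    have "connected_component S (SOME x. x \<in> C) (SOME x. x \<in> C')"
      using some[OF C] some[OF C'] in_components_subset[OF C] in_components_subset[OF C'] eq
      by (intro sep) (auto simp: \<psi>_def)
    then have "connected_component_set S (SOME x. x \<in> C) = connected_component_set S (SOME x. x \<in> C')"
      by (metis connected_component_eq mem_Collect_eq)
    moreover have "D = connected_component_set S x" if "D \<in> components S" "x \<in> D" for D x
      using that connected_component_eq[of x S] by (auto simp: components_iff)
    ultimately show "C = C'" using some[OF C] some[OF C'] C C' by metis
  qed
  have im: "\<psi> ` components S \<subseteq> F"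
  proof clarify
    fix C assume "C \<in> components S"
    then show "\<psi> C \<in> F" using some in_components_subset \<phi> unfolding \<psi>_def by blast
  qed
  show "finite (components S)" by (rule finite_imageD[OF finite_subset[OF im F] inj])
  show "card (components S) \<le> card F" by (rule card_inj_on_le[OF inj im F])
qed

text \<open>An arc does not separate the plane, and it meets \<open>K\<close> in a connected set. By
  Janiszewski's theorem, two points off both sets are separated by the union only if
  \<open>K\<close> already separates them.\<close>

lemma components_add_pendant_arc:
  fixes K :: "complex set"
  assumes K: "compact K" and g: "arc g" and Kg: "K \<inter> path_image g = {u}"
    and fin: "finite (components (- K))"
  shows "finite (components (- (K \<union> path_image g)))"
    "card (components (- (K \<union> path_image g))) \<le> card (components (- K))"
proof -
  let ?\<phi> = "connected_component_set (- K)"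
  have 1: "?\<phi> x \<in> components (- K)" if "x \<in> - (K \<union> path_image g)" for x
    using that by (auto intro: componentsI)
  have 2: "connected_component (- (K \<union> path_image g)) x y"
    if "x \<in> - (K \<union> path_image g)" "y \<in> - (K \<union> path_image g)" "?\<phi> x = ?\<phi> y" for x y
  proof (rule Janiszewski[OF K])
    show "closed (path_image g)" by (simp add: closed_arc_image g)
    show "topological_space_class.connected (K \<inter> path_image g)" using Kg by simp
    show "connected_component (- K) x y"
      using that by (auto simp: connected_component_eq_eq)
    have "topological_space_class.connected (- path_image g)"
      by (intro path_connected_imp_connected path_connected_arc_complement g) simp
    then show "connected_component (- path_image g) x y"
      using that by (intro connected_componentI[of "- path_image g"]) auto
  qed
  show "finite (components (- (K \<union> path_image g)))"
    by (rule card_components_le(1)[OF fin 1 2])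
  show "card (components (- (K \<union> path_image g))) \<le> card (components (- K))"
    by (rule card_components_le(2)[OF fin 1 2])
qed

text \<open>\<open>K\<close> and the arc meet in two points, so Janiszewski's theorem does not apply
  to them directly. An arc \<open>b\<close> inside \<open>K\<close> closes \<open>g\<close> up to a
  Jordan curve \<open>J\<close>. Now \<open>K \<inter> J\<close> is the image of \<open>b\<close>,
  which is connected, and points separated neither by \<open>K\<close> nor by \<open>J\<close> are
  not separated by the union.\<close>

lemma components_add_arc:
  fixes K :: "complex set"
  assumes K: "compact K" "path_connected K" and g: "arc g"
    and Kg: "K \<inter> path_image g = {pathstart g, pathfinish g}"
    and fin: "finite (components (- K))"
  shows "finite (components (- (K \<union> path_image g)))"
    "card (components (- (K \<union> path_image g))) \<le> Suc (card (components (- K)))"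
proof -
  have "pathfinish g \<noteq> pathstart g" using g by (simp add: arc_simple_path)
  then obtain b where b: "arc b" "path_image b \<subseteq> K" "pathstart b = pathfinish g" "pathfinish b = pathstart g"
    using K(2) Kg unfolding path_connected_arcwise by blast
  define J where "J = path_image (g +++ b)"
  have J: "J = path_image g \<union> path_image b"
    unfolding J_def using b by (simp add: path_image_join)
  have sim: "simple_path (g +++ b)"
    using b g Kg by (intro simple_path_join_loop) auto
  have loop: "pathfinish (g +++ b) = pathstart (g +++ b)" using b by simp
  note jordan = Jordan_inside_outside[OF sim loop, folded J_def]
  have KJ: "K \<inter> J = path_image b" 
  proof -
    have "{pathstart g, pathfinish g} \<subseteq> path_image b"
      using b(3,4) pathfinish_in_path_image[of b] pathstart_in_path_image[of b] by auto
    then show ?thesis using Kg b(2) unfolding J by blast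
  qed
  let ?K' = "K \<union> path_image g"
  have K'J: "?K' = K \<union> J" using J b(2) by auto
  define I where "I = path_image g - {pathstart g, pathfinish g}"
  have I: "topological_space_class.connected I" "I \<subseteq> - K"
    unfolding I_def using connected_simple_path_endless[of g] g Kg by (auto simp: arc_imp_simple_path)
  have side: "connected_component (- ?K') x y"
    if "x \<in> - ?K'" "y \<in> - ?K'" "connected_component (- K) x y" "x \<in> inside J \<longleftrightarrow> y \<in> inside J" for x y
    unfolding K'J
  proof (rule Janiszewski[OF K(1)])
    show "closed J" unfolding J_def using sim by (simp add: closed_simple_path_image)
    show "topological_space_class.connected (K \<inter> J)" using KJ b(1) by (simp add: connected_arc_image)
    show "connected_component (- K) x y" by fact
    have "x \<in> inside J \<union> outside J" "y \<in> inside J \<union> outside J"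
      using that(1,2) jordan unfolding K'J by simp_all
    then have "(x \<in> inside J \<and> y \<in> inside J) \<or> (x \<in> outside J \<and> y \<in> outside J)"
      using that(4) by blast
    moreover have "inside J \<subseteq> - J" "outside J \<subseteq> - J"
      by (auto simp: inside_def outside_def)
    ultimately show "connected_component (- J) x y"
      using jordan by (metis connected_componentI)
  qed
  \<comment> \<open>\<open>C0\<close> is the component of \<open>- K\<close> containing the open
    arc; every other component survives whole. Splitting \<open>C0\<close> by the side of
    \<open>J\<close> takes one extra label, \<open>None\<close>, which accounts for the
    \<open>Suc\<close> in the bound.\<close>
  define C0 where "C0 = {x. \<exists>i\<in>I. connected_component (- K) i x}"
  define \<phi> where "\<phi> x = (if x \<in> C0 \<and> x \<in> inside J then None else Some (connected_component_set (- K) x))" for x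
  have 1: "\<phi> x \<in> insert None (Some ` components (- K))" if "x \<in> - ?K'" for x
    using that by (auto simp: \<phi>_def intro: componentsI)
  have 2: "connected_component (- ?K') x y" if x: "x \<in> - ?K'" and y: "y \<in> - ?K'" and eq: "\<phi> x = \<phi> y" for x y
  proof (cases "x \<in> C0 \<and> x \<in> inside J")
    case True
    then have y': "y \<in> C0 \<and> y \<in> inside J" using eq by (auto simp: \<phi>_def split: if_splits)
    obtain i j where ij: "i \<in> I" "j \<in> I" "connected_component (- K) i x" "connected_component (- K) j y"
      using True y' by (auto simp: C0_def)
    have "connected_component (- K) i j" using I ij(1,2) by (intro connected_componentI[of I])
    then have "connected_component (- K) x y"
      by (intro connected_component_trans[OF connected_component_sym[OF ij(3)]]
          connected_component_trans[OF _ ij(4)])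
    then show ?thesis using side[OF x y] True y' by auto
  next
    case False
    then have y': "\<not> (y \<in> C0 \<and> y \<in> inside J)"
      and cc: "connected_component_set (- K) x = connected_component_set (- K) y"
      using eq by (auto simp: \<phi>_def split: if_splits)
    have xy: "connected_component (- K) x y"
      using cc x y by (auto simp: connected_component_eq_eq)
    show ?thesis
    proof (cases "x \<in> C0")
      case True
      then have "y \<in> C0" using connected_component_trans[OF _ xy] unfolding C0_def by blast
      then show ?thesis using side[OF x y xy] True False y' by auto
    next
      case xC: False
      let ?C = "connected_component_set (- K) x"
      have "?C \<inter> I = {}"
        using xC connected_component_sym[of "- K" x] unfolding C0_def by blast
      moreover have "?C \<subseteq> - K" by (rule connected_component_subset)
      ultimately have "?C \<subseteq> - ?K'" using Kg unfolding I_def by blast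
      moreover have "topological_space_class.connected ?C" by (rule connected_connected_component)
      moreover have "x \<in> ?C" "y \<in> ?C" using xy x by auto
      ultimately show ?thesis by (intro connected_componentI[of ?C])
    qed
  qed
  have finF: "finite (insert None (Some ` components (- K)))" using fin by simp
  have le: "card (insert None (Some ` components (- K))) \<le> Suc (card (components (- K)))"
    using fin by (simp add: card_insert_if card_image_le)
  show "finite (components (- ?K'))"
    by (rule card_components_le(1)[OF finF 1 2])
  show "card (components (- ?K')) \<le> Suc (card (components (- K)))"
    using card_components_le(2)[OF finF 1 2] le by (rule le_trans)
qed

section \<open>Cuts and trees\<close>

definition closed_under :: "('e \<Rightarrow> 'v) \<Rightarrow> ('e \<Rightarrow> 'v) \<Rightarrow> 'e set \<Rightarrow> 'v set \<Rightarrow> bool" where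
  "closed_under t h T X \<longleftrightarrow> (\<forall>e\<in>T. t e \<in> X \<longleftrightarrow> h e \<in> X)"

definition spans :: "'v set \<Rightarrow> ('e \<Rightarrow> 'v) \<Rightarrow> ('e \<Rightarrow> 'v) \<Rightarrow> 'e set \<Rightarrow> bool" where
  "spans V t h T \<longleftrightarrow> (\<forall>X\<subseteq>V. closed_under t h T X \<longrightarrow> X = {} \<or> X = V)"

text \<open>\<open>X\<close> may contain points outside the vertex set, so that level sets of
  functions can serve as witnesses.\<close>

definition all_bridges :: "('e \<Rightarrow> 'v) \<Rightarrow> ('e \<Rightarrow> 'v) \<Rightarrow> 'e set \<Rightarrow> bool" where
  "all_bridges t h T \<longleftrightarrow>
     (\<forall>e\<in>T. \<exists>X. (t e \<in> X \<longleftrightarrow> h e \<notin> X) \<and> closed_under t h (T - {e}) X)"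

definition cut_tree :: "'v set \<Rightarrow> ('e \<Rightarrow> 'v) \<Rightarrow> ('e \<Rightarrow> 'v) \<Rightarrow> 'e set \<Rightarrow> bool" where
  "cut_tree V t h T \<longleftrightarrow> spans V t h T \<and> all_bridges t h T"

text \<open>Reachability from \<open>r\<close> in cut form; on trees it singles out the
  arborescences with root \<open>r\<close>. The set where a potential is at most, or at least, its
  value at \<open>r\<close> can be inserted for \<open>X\<close>.\<close>

definition rooted_at :: "'v set \<Rightarrow> ('e \<Rightarrow> 'v) \<Rightarrow> ('e \<Rightarrow> 'v) \<Rightarrow> 'v \<Rightarrow> 'e set \<Rightarrow> bool" where
  "rooted_at V t h r A \<longleftrightarrow> (\<forall>X\<subseteq>V. r \<in> X \<longrightarrow> (\<forall>e\<in>A. t e \<in> X \<longrightarrow> h e \<in> X) \<longrightarrow> X = V)"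

text \<open>Under symmetric difference these sets form a vector space over the field with two elements, whose
  dimension is the number of connected components.\<close>
definition closed_sets :: "'v set \<Rightarrow> ('e \<Rightarrow> 'v) \<Rightarrow> ('e \<Rightarrow> 'v) \<Rightarrow> 'e set \<Rightarrow> 'v set set" where
  "closed_sets V t h T = {X. X \<subseteq> V \<and> closed_under t h T X}"

lemma closed_under_mono: "closed_under t h T X \<Longrightarrow> S \<subseteq> T \<Longrightarrow> closed_under t h S X"
  by (auto simp: closed_under_def)

lemma finite_closed_sets: "finite V \<Longrightarrow> finite (closed_sets V t h T)"
  unfolding closed_sets_def by (rule finite_subset[of _ "Pow V"]) auto

text \<open>Symmetric difference with one closed set crossed by \<open>e\<close> maps all closed
  sets crossed by \<open>e\<close> injectively to sets not crossed by it: the subspace has index at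
  most 2.\<close>

lemma card_closed_sets_insert_le:
  assumes V: "finite V"
  shows "card (closed_sets V t h T) \<le> 2 * card (closed_sets V t h (insert e T))"
proof -
  let ?A = "closed_sets V t h T" and ?B = "closed_sets V t h (insert e T)"
  have fin: "finite ?A" "finite ?B" using finite_closed_sets V by auto
  have BA: "?B \<subseteq> ?A" by (auto simp: closed_sets_def closed_under_def)
  have "card (?A - ?B) \<le> card ?B"
  proof (cases "?A - ?B = {}")
    case False
    then obtain X0 where X0: "X0 \<in> ?A - ?B" by blast
    let ?f = "\<lambda>X. (X - X0) \<union> (X0 - X)"
    show ?thesis
    proof (rule card_inj_on_le[OF _ _ fin(2)])
      show "inj_on ?f (?A - ?B)" by (rule inj_onI) blast
      show "?f ` (?A - ?B) \<subseteq> ?B"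
        using X0 by (auto simp: closed_sets_def closed_under_def)
    qed
  qed (metis card.empty le0)
  then show ?thesis using card_Diff_subset[OF fin(2) BA] by simp
qed

text \<open>The bridge witness \<open>X0\<close> provides a translation out of the subspace, so the
  index is exactly 2. As \<open>X0\<close> may leave \<open>V\<close>, it is first cut down to
  \<open>V\<close>.\<close>

lemma card_closed_sets_insert_bridge:
  assumes V: "finite V" and ends: "range t \<subseteq> V" "range h \<subseteq> V"
    and X0: "t e \<in> X0 \<longleftrightarrow> h e \<notin> X0" "closed_under t h T X0"
  shows "card (closed_sets V t h T) = 2 * card (closed_sets V t h (insert e T))"
proof -
  let ?A = "closed_sets V t h T" and ?B = "closed_sets V t h (insert e T)"
  have fin: "finite ?A" "finite ?B" using finite_closed_sets V by auto
  have BA: "?B \<subseteq> ?A" by (auto simp: closed_sets_def closed_under_def)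
  let ?f = "\<lambda>X. (X - (X0 \<inter> V)) \<union> ((X0 \<inter> V) - X)"
  have "card ?B \<le> card (?A - ?B)"
  proof (rule card_inj_on_le)
    show "inj_on ?f ?B" by (rule inj_onI) blast
    show "?f ` ?B \<subseteq> ?A - ?B"
    proof clarify
      fix X assume X: "X \<in> ?B"
      have "t e \<in> V" "h e \<in> V" using ends by auto
      then have "t e \<in> ?f X \<longleftrightarrow> h e \<notin> ?f X"
        using X X0(1) unfolding closed_sets_def closed_under_def by blast
      then have "?f X \<notin> ?B" unfolding closed_sets_def closed_under_def by blast
      moreover have "t x \<in> ?f X \<longleftrightarrow> h x \<in> ?f X" if "x \<in> T" for x
      proof -
        have "t x \<in> V" "h x \<in> V" using ends by auto
        moreover have "t x \<in> X \<longleftrightarrow> h x \<in> X" "t x \<in> X0 \<longleftrightarrow> h x \<in> X0"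
          using X X0(2) that unfolding closed_sets_def closed_under_def by auto
        ultimately show ?thesis by blast
      qed
      then have "?f X \<in> ?A" using X unfolding closed_sets_def closed_under_def by blast
      ultimately show "?f X \<in> ?A - ?B" by blast
    qed
  qed (use fin in auto)
  moreover have "card (?A - ?B) = card ?A - card ?B" "card ?B \<le> card ?A"
    using card_Diff_subset[OF fin(2) BA] card_mono[OF fin(1) BA] by auto
  ultimately have "2 * card ?B \<le> card ?A" by simp
  then show ?thesis using card_closed_sets_insert_le[OF V, of t h T e] by simp
qed

lemma closed_sets_empty: "closed_sets V t h {} = Pow V"
  by (auto simp: closed_sets_def closed_under_def)

lemma card_closed_sets_ge:
  assumes "finite V" "finite T"
  shows "2 ^ card V \<le> 2 ^ card T * card (closed_sets V t h T)"
  using assms(2)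
proof (induction T rule: finite_induct)
  case empty
  then show ?case using assms(1) by (simp add: closed_sets_empty card_Pow)
next
  case (insert e T)
  have "2 ^ card V \<le> 2 ^ card T * card (closed_sets V t h T)" by fact
  also have "\<dots> \<le> 2 ^ card T * (2 * card (closed_sets V t h (insert e T)))"
    by (intro mult_left_mono card_closed_sets_insert_le assms) simp
  finally show ?case using insert by (simp add: ac_simps)
qed

lemma all_bridges_subset: "all_bridges t h T \<Longrightarrow> S \<subseteq> T \<Longrightarrow> all_bridges t h S"
  unfolding all_bridges_def by (meson Diff_mono closed_under_mono order_refl subsetD)

lemma card_closed_sets_all_bridges:
  assumes V: "finite V" and ends: "range t \<subseteq> V" "range h \<subseteq> V" and T: "finite T" "all_bridges t h T"
  shows "2 ^ card V = 2 ^ card T * card (closed_sets V t h T)"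
  using T
proof (induction T rule: finite_induct)
  case empty
  then show ?case using V by (simp add: closed_sets_empty card_Pow)
next
  case (insert e T)
  have IH: "2 ^ card V = 2 ^ card T * card (closed_sets V t h T)"
    using insert.IH all_bridges_subset[OF insert.prems] by blast
  have "insert e T - {e} = T" using insert.hyps by auto
  then obtain X0 where "t e \<in> X0 \<longleftrightarrow> h e \<notin> X0" "closed_under t h T X0"
    using insert.prems unfolding all_bridges_def by (metis insertI1)
  then have "card (closed_sets V t h T) = 2 * card (closed_sets V t h (insert e T))"
    by (rule card_closed_sets_insert_bridge[OF V ends])
  then show ?case using IH insert.hyps by (simp add: ac_simps)
qed

lemma two_closed_sets:
  assumes "finite V" "V \<noteq> {}" "range t \<subseteq> V" "range h \<subseteq> V"
  shows "{{}, V} \<subseteq> closed_sets V t h T" "card {{}, V} = (2::nat)"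
    "2 \<le> card (closed_sets V t h T)"
proof -
  show 1: "{{}, V} \<subseteq> closed_sets V t h T"
    using assms by (auto simp: closed_sets_def closed_under_def)
  show 2: "card {{}, V} = (2::nat)" using assms by simp
  show "2 \<le> card (closed_sets V t h T)"
    using card_mono[OF finite_closed_sets 1] assms 2 by simp
qed

lemma spans_iff_card:
  assumes "finite V" "V \<noteq> {}" "range t \<subseteq> V" "range h \<subseteq> V"
  shows "spans V t h T \<longleftrightarrow> card (closed_sets V t h T) = 2"
proof
  assume "spans V t h T"
  then have "closed_sets V t h T \<subseteq> {{}, V}" unfolding spans_def closed_sets_def by blast
  then show "card (closed_sets V t h T) = 2"
    using two_closed_sets[OF assms] by (metis subset_antisym)
next
  assume "card (closed_sets V t h T) = 2"
  then have "{{}, V} = closed_sets V t h T"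
    using two_closed_sets(1)[OF assms, of T] two_closed_sets(2)[OF assms]
    by (intro card_subset_eq finite_closed_sets assms(1)) simp_all
  then show "spans V t h T" unfolding spans_def closed_sets_def by blast
qed

lemma two_pow_le: "(2::nat) ^ a \<le> 2 ^ b * 2 \<longleftrightarrow> a \<le> Suc b"
  using power_increasing_iff[of "2::nat" a "Suc b"] by (simp add: mult.commute)

lemma all_bridges_card_le:
  assumes "finite V" "V \<noteq> {}" "range t \<subseteq> V" "range h \<subseteq> V" "finite T" "all_bridges t h T"
  shows "card T + 1 \<le> card V"
proof -
  have "2 ^ card T * 2 \<le> 2 ^ card T * card (closed_sets V t h T)"
    using two_closed_sets(3)[OF assms(1-4), of T] by simp
  also have "\<dots> = 2 ^ card V" using card_closed_sets_all_bridges[OF assms(1,3-6)] by simp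
  finally have "(2::nat) ^ Suc (card T) \<le> 2 ^ card V" by simp
  then show ?thesis by (subst (asm) power_increasing_iff) auto
qed

lemma spans_card_ge:
  assumes "finite V" "V \<noteq> {}" "range t \<subseteq> V" "range h \<subseteq> V" "finite T" "spans V t h T"
  shows "card V \<le> card T + 1"
  using card_closed_sets_ge[OF assms(1,5), of t h] spans_iff_card[OF assms(1-4), of T] assms(6)
  by (simp add: two_pow_le)

text \<open>For an acyclic set the number of closed sets is exactly
  \<open>2 ^ (card V - card T)\<close>, so the edge count decides whether only the two trivial ones
  are left.\<close>

lemma cut_tree_iff_bridges_card:
  assumes "finite V" "V \<noteq> {}" "range t \<subseteq> V" "range h \<subseteq> V" "finite T"
  shows "cut_tree V t h T \<longleftrightarrow> all_bridges t h T \<and> card T + 1 = card V"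
proof -
  have "spans V t h T \<longleftrightarrow> card T + 1 = card V" if "all_bridges t h T"
  proof
    show "spans V t h T \<Longrightarrow> card T + 1 = card V"
      using spans_card_ge[OF assms] all_bridges_card_le[OF assms that] by simp
    assume "card T + 1 = card V"
    then have "2 ^ card T * 2 = 2 ^ card T * card (closed_sets V t h T)"
      using card_closed_sets_all_bridges[OF assms(1,3-5) that] by (metis Suc_eq_plus1 power_Suc2)
    then show "spans V t h T" using spans_iff_card[OF assms(1-4), of T] by simp
  qed
  then show ?thesis unfolding cut_tree_def by blast
qed

text \<open>A spanning set of this size is minimal: without \<open>e\<close> there are too few edges
  to span, and the nontrivial closed set that then appears is a cut crossed only by
  \<open>e\<close>.\<close>

lemma cut_tree_iff_spans_card:
  assumes "finite V" "V \<noteq> {}" "range t \<subseteq> V" "range h \<subseteq> V" "finite T"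
  shows "cut_tree V t h T \<longleftrightarrow> spans V t h T \<and> card T + 1 = card V"
proof
  assume "cut_tree V t h T"
  then show "spans V t h T \<and> card T + 1 = card V"
    using cut_tree_iff_bridges_card[OF assms] unfolding cut_tree_def by blast
next
  assume T: "spans V t h T \<and> card T + 1 = card V"
  have "all_bridges t h T"
    unfolding all_bridges_def
  proof
    fix e assume e: "e \<in> T"
    have "card (T - {e}) + 1 < card V" using T e assms(5) by (metis card_Diff1_less add_less_mono1)
    then have "\<not> spans V t h (T - {e})"
      using spans_card_ge[OF assms(1-4), of "T - {e}"] assms(5) by (meson finite_Diff not_le)
    then obtain X where X: "X \<subseteq> V" "closed_under t h (T - {e}) X" "X \<noteq> {}" "X \<noteq> V"
      unfolding spans_def by blast
    then have "\<not> closed_under t h T X" using T unfolding spans_def by blast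
    then show "\<exists>X. (t e \<in> X \<longleftrightarrow> h e \<notin> X) \<and> closed_under t h (T - {e}) X"
      using X(2) unfolding closed_under_def by blast
  qed
  then show "cut_tree V t h T" using T unfolding cut_tree_def by blast
qed

lemma ex_cut_tree:
  assumes "finite V" "V \<noteq> {}" "range t \<subseteq> V" "range h \<subseteq> V" "finite E" "spans V t h E"
  shows "\<exists>T\<subseteq>E. cut_tree V t h T"
proof -
  obtain T where T: "T \<subseteq> E" "spans V t h T" "\<And>S. S \<subseteq> E \<and> spans V t h S \<Longrightarrow> card T \<le> card S"
    using ex_has_least_nat[of "\<lambda>T. T \<subseteq> E \<and> spans V t h T" E card] assms(6) by blast
  have finT: "finite T" using T(1) assms(5) finite_subset by blast
  have "all_bridges t h T"
    unfolding all_bridges_def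
  proof
    fix e assume e: "e \<in> T"
    then have "card (T - {e}) < card T" using finT by (intro card_Diff1_less)
    then have "\<not> spans V t h (T - {e})" using T(1) T(3)[of "T - {e}"] by auto
    then obtain X where X: "X \<subseteq> V" "closed_under t h (T - {e}) X" "X \<noteq> {}" "X \<noteq> V"
      unfolding spans_def by blast
    then have "\<not> closed_under t h T X" using T unfolding spans_def by blast
    then show "\<exists>X. (t e \<in> X \<longleftrightarrow> h e \<notin> X) \<and> closed_under t h (T - {e}) X"
      using X(2) unfolding closed_under_def by blast
  qed
  then show ?thesis using T unfolding cut_tree_def by blast
qed

lemma spans_const:
  assumes "spans V t h T" "range t \<subseteq> V" "range h \<subseteq> V" "\<And>e. e \<in> T \<Longrightarrow> w (t e) = w (h e)" "u \<in> V" "v \<in> V"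
  shows "w u = w v"
proof -
  have "closed_under t h T {x \<in> V. w x = w u}"
    using assms(2,3,4) by (simp add: closed_under_def image_subset_iff)
  then have "{x \<in> V. w x = w u} = {} \<or> {x \<in> V. w x = w u} = V"
    using assms(1) unfolding spans_def by (metis (no_types, lifting) mem_Collect_eq subsetI)
  then show ?thesis using assms(5,6) by (metis (mono_tags, lifting) empty_iff mem_Collect_eq)
qed

section \<open>Real chains and their boundaries\<close>

text \<open>The boundary operator on real 1-chains, with edges oriented from \<open>t\<close> to
  \<open>h\<close>; its kernel is the cycle space.\<close>

definition boundary :: "('e::finite \<Rightarrow> 'v) \<Rightarrow> ('e \<Rightarrow> 'v) \<Rightarrow> ('e \<Rightarrow> real) \<Rightarrow> 'v \<Rightarrow> real" where
  "boundary t h c v = (\<Sum>e\<in>UNIV. c e * (of_bool (h e = v) - of_bool (t e = v)))"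

lemma boundary_add: "boundary t h (\<lambda>e. c e + d e) v = boundary t h c v + boundary t h d v"
  by (simp add: boundary_def distrib_right sum.distrib)

lemma boundary_single:
  "boundary t h (\<lambda>x. k * of_bool (x = e)) v = k * (of_bool (h e = v) - of_bool (t e = v))"
proof -
  have "boundary t h (\<lambda>x. k * of_bool (x = e)) v
      = (\<Sum>x\<in>UNIV. if x = e then k * (of_bool (h x = v) - of_bool (t x = v)) else 0)"
    unfolding boundary_def by (intro sum.cong) auto
  then show ?thesis by simp
qed

text \<open>Discrete divergence theorem: edges within \<open>X\<close> cancel and the net flow into
  \<open>X\<close> remains. For a cycle it vanishes, so no cut meets the support of a cycle in a
  single edge.\<close>

lemma sum_boundary:
  fixes t h :: "'e::finite \<Rightarrow> 'v::finite"
  shows "(\<Sum>v\<in>X. boundary t h c v) = (\<Sum>e\<in>UNIV. c e * (of_bool (h e \<in> X) - of_bool (t e \<in> X)))"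
proof -
  have *: "(\<Sum>v\<in>X. of_bool (x = v)) = (of_bool (x \<in> X) :: real)" for x :: 'v
    by (simp add: of_bool_def)
  have "(\<Sum>v\<in>X. boundary t h c v)
      = (\<Sum>e\<in>UNIV. \<Sum>v\<in>X. c e * (of_bool (h e = v) - of_bool (t e = v)))"
    unfolding boundary_def by (rule sum.swap)
  also have "\<dots> = (\<Sum>e\<in>UNIV. c e * (of_bool (h e \<in> X) - of_bool (t e \<in> X)))"
    by (simp add: sum_distrib_left[symmetric] sum_subtractf *)
  finally show ?thesis .
qed

text \<open>The vertices reached from \<open>u\<close> by unit flows on \<open>T\<close> form a set
  that no edge of \<open>T\<close> leaves. The flow takes the place of a path in \<open>T\<close>,
  without a choice of a walk.\<close>

lemma chain_or_cut:
  fixes t h :: "'e::finite \<Rightarrow> 'v"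
  obtains (chain) c where "\<And>e. e \<notin> T \<Longrightarrow> c e = 0"
      "\<And>x. boundary t h c x = of_bool (x = v) - of_bool (x = u)"
  | (cut) X where "u \<in> X" "v \<notin> X" "closed_under t h T X"
proof -
  let ?P = "\<lambda>v c. (\<forall>e. e \<notin> T \<longrightarrow> c e = 0) \<and> (\<forall>x. boundary t h c x = of_bool (x = v) - of_bool (x = u))"
  define X where "X = {v. \<exists>c. ?P v c}"
  have step: "\<exists>c. ?P b c" if "?P a c" "e \<in> T" "(k = 1 \<and> a = t e \<and> b = h e) \<or> (k = - 1 \<and> a = h e \<and> b = t e)"
    for a b c e and k :: real
    using that
    by (intro exI[of _ "\<lambda>x. c x + k * of_bool (x = e)"]) (auto simp: boundary_add boundary_single)
  have "closed_under t h T X"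
    unfolding closed_under_def
  proof
    fix e assume e: "e \<in> T"
    have "\<exists>c. ?P (h e) c" if "?P (t e) c" for c
      by (rule step[OF that e, of 1]) simp
    moreover have "\<exists>c. ?P (t e) c" if "?P (h e) c" for c
      by (rule step[OF that e, of "- 1"]) simp
    ultimately show "t e \<in> X \<longleftrightarrow> h e \<in> X" unfolding X_def by blast
  qed
  moreover have "u \<in> X" unfolding X_def
    by (auto intro!: exI[of _ "\<lambda>_. 0"] simp: boundary_def)
  moreover have thesis if "v \<in> X"
  proof -
    have "\<exists>c. ?P v c" using that by (simp only: X_def mem_Collect_eq)
    then obtain c where "?P v c" ..
    then show thesis using chain[of c] by blast
  qed
  ultimately show thesis using cut[of X] by blast
qed

section \<open>Interchange of the color classes\<close>

lemma spans_Inl_Inr_swap: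
  assumes "spans UNIV (\<lambda>e. Inl (p e)) (\<lambda>e. Inr (q e)) T"
  shows "spans UNIV (\<lambda>e. Inl (q e)) (\<lambda>e. Inr (p e)) T"
  unfolding spans_def
proof (intro allI impI)
  fix X :: "('b + 'a) set"
  let ?Y = "case_sum Inr Inl -` X"
  assume "closed_under (\<lambda>e. Inl (q e)) (\<lambda>e. Inr (p e)) T X"
  then have "closed_under (\<lambda>e. Inl (p e)) (\<lambda>e. Inr (q e)) T ?Y"
    by (auto simp: closed_under_def)
  then have "?Y = {} \<or> ?Y = UNIV" using assms unfolding spans_def by blast
  moreover have "x \<in> X \<longleftrightarrow> case_sum Inr Inl x \<in> ?Y" for x
    by (cases x) simp_all
  ultimately show "X = {} \<or> X = UNIV" by blast
qed

lemma all_bridges_Inl_Inr_swap: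
  assumes "all_bridges (\<lambda>e. Inl (p e)) (\<lambda>e. Inr (q e)) T"
  shows "all_bridges (\<lambda>e. Inl (q e)) (\<lambda>e. Inr (p e)) T"
  unfolding all_bridges_def
proof
  fix e assume "e \<in> T"
  then obtain X where "(Inl (p e) \<in> X) = (Inr (q e) \<notin> X)" "closed_under (\<lambda>e. Inl (p e)) (\<lambda>e. Inr (q e)) (T - {e}) X"
    using assms unfolding all_bridges_def by blast
  then show "\<exists>X. (Inl (q e) \<in> X) = (Inr (p e) \<notin> X) \<and> closed_under (\<lambda>e. Inl (q e)) (\<lambda>e. Inr (p e)) (T - {e}) X"
    by (intro exI[of _ "case_sum Inr Inl -` X"]) (auto simp: closed_under_def)
qed

lemma cut_tree_Inl_Inr_swap:
  "cut_tree UNIV (\<lambda>e. Inl (q e)) (\<lambda>e. Inr (p e)) T \<longleftrightarrow> cut_tree UNIV (\<lambda>e. Inl (p e)) (\<lambda>e. Inr (q e)) T"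
  unfolding cut_tree_def
  by (intro iffI conjI) (blast intro: spans_Inl_Inr_swap all_bridges_Inl_Inr_swap)+

section \<open>Dual trees\<close>

text \<open>Edges of the graph and arcs of the dual share the type \<open>'e\<close>.
  \<open>potential\<close> is one half of planar duality, cycles being cuts of the dual;
  \<open>euler\<close> yields the other half by a dimension count.\<close>

locale planar_dual =
  fixes t h :: "'e::finite \<Rightarrow> 'v::finite" and R :: "'r set" and dt dh :: "'e \<Rightarrow> 'r"
  assumes spans_UNIV: "spans UNIV t h UNIV"
    and finite_R: "finite R" and R_ne: "R \<noteq> {}"
    and range_dt: "range dt \<subseteq> R" and range_dh: "range dh \<subseteq> R"
    and potential: "(\<And>v. boundary t h c v = 0) \<Longrightarrow> \<exists>w. \<forall>e. w (dh e) - w (dt e) = (c e :: real)"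
    and euler: "card R + card (UNIV :: 'v set) \<le> card (UNIV :: 'e set) + 2"
begin

abbreviation primal_tree :: "'e set \<Rightarrow> bool" where "primal_tree T \<equiv> cut_tree UNIV t h T"
abbreviation dual_tree :: "'e set \<Rightarrow> bool" where "dual_tree A \<equiv> cut_tree R dt dh A"

lemmas dual_ends = finite_R R_ne range_dt range_dh
lemma primal_ends: "finite (UNIV :: 'v set)" "(UNIV :: 'v set) \<noteq> {}" "range t \<subseteq> UNIV" "range h \<subseteq> UNIV"
  by simp_all

text \<open>A unit flow through \<open>T\<close> from the head of \<open>e\<close> to its tail is
  closed up by \<open>e\<close>. For \<open>e\<close> outside \<open>T\<close>, the potential of
  this cycle changes along no dual arc of \<open>- T\<close> except \<open>e\<close>, and so
  describes the fundamental cut of \<open>e\<close>.\<close>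

lemma fundamental_cycle:
  assumes "spans UNIV t h T"
  obtains c w where "\<And>v. boundary t h c v = 0" "\<And>x. x \<notin> insert e T \<Longrightarrow> c x = 0" "e \<notin> T \<Longrightarrow> c e = 1"
    "\<And>x. w (dh x) - w (dt x) = c x"
proof (rule chain_or_cut[of T t h "t e" "h e"])
  fix c assume c: "\<And>x. x \<notin> T \<Longrightarrow> c x = 0"
    "\<And>x. boundary t h c x = of_bool (x = t e) - of_bool (x = h e)"
  let ?c = "\<lambda>x. c x + 1 * of_bool (x = e)"
  have 1: "boundary t h ?c v = 0" for v
    unfolding boundary_add boundary_single c(2) by auto
  obtain w where "\<forall>x. w (dh x) - w (dt x) = ?c x" using potential[of ?c, OF 1] by blast
  then show thesis using that[of ?c w] 1 c(1) by auto
next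
  fix X assume "h e \<in> X" "t e \<notin> X" "closed_under t h T X"
  then show thesis using assms unfolding spans_def by blast
qed

lemma dual_all_bridges:
  assumes "spans UNIV t h T"
  shows "all_bridges dt dh (- T)"
  unfolding all_bridges_def
proof
  fix e assume e: "e \<in> - T"
  obtain c w where c: "\<And>x. x \<notin> insert e T \<Longrightarrow> c x = 0" "e \<notin> T \<Longrightarrow> c e = (1::real)"
    "\<And>x. w (dh x) - w (dt x) = c x"
    using fundamental_cycle[OF assms, of e] by metis
  have "w (dt e) \<noteq> w (dh e)" using c(2) c(3)[of e] e by auto
  moreover have "w (dt x) = w (dh x)" if "x \<in> - T - {e}" for x
    using c(1)[of x] c(3)[of x] that by auto
  ultimately show "\<exists>X. (dt e \<in> X) = (dh e \<notin> X) \<and> closed_under dt dh (- T - {e}) X"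
    by (intro exI[of _ "{x. w x = w (dh e)}"]) (auto simp: closed_under_def)
qed

lemma card_Compl: "card (- T) = card (UNIV :: 'e set) - card (T :: 'e set)" "card T \<le> card (UNIV :: 'e set)"
  by (simp_all add: card_Diff_subset[symmetric] Compl_eq_Diff_UNIV card_mono)

text \<open>As an acyclic set, \<open>- T\<close> has fewer than \<open>card R\<close> edges, while
  \<open>euler\<close> forces at least \<open>card R - 1\<close>. Equality makes \<open>- T\<close>
  a tree and turns the bound into Euler's formula.\<close>

lemma dual_tree_Compl:
  assumes "primal_tree T"
  shows "dual_tree (- T)" "card R + card (UNIV :: 'v set) = card (UNIV :: 'e set) + 2"
proof -
  have T: "spans UNIV t h T" "card T + 1 = card (UNIV :: 'v set)"
    using assms cut_tree_iff_spans_card[OF primal_ends finite[of T]] by auto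
  have b: "all_bridges dt dh (- T)" by (rule dual_all_bridges[OF T(1)])
  have "card (- T) + 1 \<le> card R" by (rule all_bridges_card_le[OF dual_ends finite b])
  then have *: "card (- T) + 1 = card R" using euler T(2) card_Compl[of T] by linarith
  then show "dual_tree (- T)" using b cut_tree_iff_bridges_card[OF dual_ends finite[of "- T"]] by blast
  show "card R + card (UNIV :: 'v set) = card (UNIV :: 'e set) + 2"
    using * T(2) card_Compl[of T] by linarith
qed

lemma euler_formula: "card R + card (UNIV :: 'v set) = card (UNIV :: 'e set) + 2"
  using ex_cut_tree[OF primal_ends finite spans_UNIV] dual_tree_Compl(2) by blast

text \<open>If \<open>e\<close> closed a cycle in \<open>- A\<close>, the potential of this cycle
  would be constant along the spanning set \<open>A\<close>, hence on all regions, although it jumps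
  by 1 along \<open>e\<close>.\<close>

lemma primal_tree_Compl:
  assumes "dual_tree A"
  shows "primal_tree (- A)"
proof -
  have A: "spans R dt dh A" "card A + 1 = card R"
    using assms cut_tree_iff_spans_card[OF dual_ends finite[of A]] by auto
  have "all_bridges t h (- A)"
    unfolding all_bridges_def
  proof
    fix e assume e: "e \<in> - A"
    show "\<exists>X. (t e \<in> X) = (h e \<notin> X) \<and> closed_under t h (- A - {e}) X"
    proof (rule chain_or_cut[of "- A - {e}" t h "t e" "h e"])
      fix c assume c: "\<And>x. x \<notin> - A - {e} \<Longrightarrow> c x = 0"
        "\<And>x. boundary t h c x = of_bool (x = t e) - of_bool (x = h e)"
      let ?c = "\<lambda>x. c x + 1 * of_bool (x = e)"
      have 1: "boundary t h ?c v = 0" for v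
        unfolding boundary_add boundary_single c(2) by auto
      obtain w where w: "\<forall>x. w (dh x) - w (dt x) = ?c x" using potential[of ?c, OF 1] by blast
      have "w (dt x) = w (dh x)" if "x \<in> A" for x
      proof -
        have "c x = 0" "x \<noteq> e" using c(1)[of x] that e by auto
        then show ?thesis using w[rule_format, of x] by simp
      qed
      then have "w (dt e) = w (dh e)"
        using spans_const[OF A(1) range_dt range_dh, of w "dt e" "dh e"] range_dt range_dh by blast
      then have False using w[rule_format, of e] c(1)[of e] by simp
      then show ?thesis ..
    qed auto
  qed
  moreover have "card (- A) + 1 = card (UNIV :: 'v set)"
    using A(2) euler_formula card_Compl[of A] by linarith
  ultimately show ?thesis using cut_tree_iff_bridges_card[OF primal_ends finite[of "- A"]] by blast
qed

text \<open>By \<open>sum_boundary\<close> the cycle cannot cross a cut in \<open>f\<close> alone. A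
  set closed under the exchanged edges is therefore closed under \<open>f\<close> as well, hence
  under \<open>T\<close>.\<close>

lemma spans_exchange:
  assumes T: "spans UNIV t h T" and c: "\<And>v. boundary t h c v = 0"
    "\<And>x. x \<notin> insert e T \<Longrightarrow> c x = 0" "c f \<noteq> 0"
  shows "spans UNIV t h (insert e T - {f})"
  unfolding spans_def
proof (intro allI impI)
  fix X assume X: "closed_under t h (insert e T - {f}) X"
  have "0 = (\<Sum>v\<in>X. boundary t h c v)" using c(1) by simp
  also have "\<dots> = (\<Sum>x\<in>UNIV. c x * (of_bool (h x \<in> X) - of_bool (t x \<in> X)))"
    by (rule sum_boundary)
  also have "\<dots> = (\<Sum>x\<in>{f}. c x * (of_bool (h x \<in> X) - of_bool (t x \<in> X)))"
    using X c(2) by (intro sum.mono_neutral_right) (auto simp: closed_under_def)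
  finally have "t f \<in> X \<longleftrightarrow> h f \<in> X" using c(3) by (auto split: if_splits)
  then have "closed_under t h T X" using X by (auto simp: closed_under_def)
  then show "X = {} \<or> X = UNIV" using T unfolding spans_def by blast
qed

section \<open>Redirecting dual trees away from a root\<close>

definition forward :: "'r \<Rightarrow> 'e set \<Rightarrow> 'r set" where
  "forward r A = {v. (r, v) \<in> {(dt e, dh e) | e. e \<in> A}\<^sup>*}"

lemma forward_root: "r \<in> forward r A"
  by (simp add: forward_def)

lemma forward_step: "dt e \<in> forward r A \<Longrightarrow> e \<in> A \<Longrightarrow> dh e \<in> forward r A"
  unfolding forward_def by (auto intro: rtrancl_into_rtrancl)

text \<open>The assumption that \<open>dt e\<close> is itself reachable allows arcs starting outside
  the reachable part to be ignored, such as the arc that is about to be exchanged.\<close>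

lemma forward_least:
  assumes "r \<in> X" "\<And>e. e \<in> A \<Longrightarrow> dt e \<in> X \<Longrightarrow> dt e \<in> forward r A \<Longrightarrow> dh e \<in> X"
  shows "forward r A \<subseteq> X"
proof
  fix v assume "v \<in> forward r A"
  then have "(r, v) \<in> {(dt e, dh e) | e. e \<in> A}\<^sup>*" by (simp add: forward_def)
  then have "v \<in> X \<and> v \<in> forward r A"
  proof (induction rule: rtrancl_induct)
    case base
    then show ?case using assms(1) forward_root by simp
  next
    case (step y z)
    then show ?case using assms(2) forward_step by blast
  qed
  then show "v \<in> X" by simp
qed

lemma forward_subset: "r \<in> R \<Longrightarrow> forward r A \<subseteq> R"
  using range_dh by (intro forward_least) auto

lemma rooted_at_iff: "r \<in> R \<Longrightarrow> rooted_at R dt dh r A \<longleftrightarrow> forward r A = R"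
proof
  assume r: "r \<in> R" and "rooted_at R dt dh r A"
  then show "forward r A = R"
    using forward_subset[OF r] forward_root forward_step unfolding rooted_at_def by metis
next
  assume "r \<in> R" and "forward r A = R"
  then show "rooted_at R dt dh r A"
    unfolding rooted_at_def using forward_least[of r _ A] by (metis subset_antisym)
qed

text \<open>Let \<open>S\<close> be the part of the dual tree that is already directed away from \<open>r\<close>.  An arc \<open>e\<close>
  of the dual tree entering \<open>S\<close> is traded for an arc \<open>f\<close> leaving the side of \<open>r\<close> in the fundamental
  cut of \<open>e\<close>, where \<open>f\<close> is chosen with the same endpoint \<open>p f = p e\<close>.  Then \<open>S\<close> grows or the
  number of arcs entering \<open>S\<close> drops.\<close>
lemma ex_rooted_tree:
  assumes p: "\<And>c a. (\<And>v. boundary t h c v = 0) \<Longrightarrow> (\<Sum>e | p e = a. c e) = 0"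
    and r: "r \<in> R" and T: "primal_tree T"
  shows "\<exists>T'. primal_tree T' \<and> (\<forall>a. card {e\<in>T'. p e = a} = card {e\<in>T. p e = a})
    \<and> rooted_at R dt dh r (- T')"
proof -
  define S where "S T = forward r (- T)" for T
  define B where "B T = {e \<in> - T. dh e \<in> S T \<and> dt e \<notin> S T}" for T
  let ?m = "measures [\<lambda>T. card R - card (S T), \<lambda>T. card (B T)]"
  have "wf ?m" by simp
  then show ?thesis using T
  proof (induction T rule: wf_induct_rule)
    case (less T)
    have A: "dual_tree (- T)" and Tsp: "spans UNIV t h T"
      using dual_tree_Compl less.prems unfolding cut_tree_def by auto
    then have Asp: "spans R dt dh (- T)" unfolding cut_tree_def by blast
    have SR: "S T \<subseteq> R" unfolding S_def by (rule forward_subset[OF r])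
    show ?case
    proof (cases "S T = R")
      case True
      then show ?thesis using less.prems r unfolding S_def rooted_at_iff[OF r] by blast
    next
      case False
      then have "\<not> closed_under dt dh (- T) (S T)"
        using Asp SR forward_root[of r] unfolding spans_def S_def by blast
      then obtain e where e: "e \<in> B T"
        using forward_step[of _ r "- T"] unfolding B_def S_def closed_under_def by blast
      then have eT: "e \<notin> T" "dh e \<in> S T" "dt e \<notin> S T" unfolding B_def by auto
      obtain c w where c: "\<And>v. boundary t h c v = 0" "\<And>x. x \<notin> insert e T \<Longrightarrow> c x = 0" "c e = 1"
        and w: "\<And>x. w (dh x) - w (dt x) = c x"
        using fundamental_cycle[OF Tsp, of e] eT(1) by metis
      \<comment> \<open>The alternation of cycles in real form: the coefficients at the vertex
        \<open>p e\<close> sum to zero and \<open>c e = 1\<close>, so another edge there has a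
        negative coefficient.\<close>
      have "\<exists>f. p f = p e \<and> c f < 0"
      proof (rule ccontr)
        assume "\<not> ?thesis"
        then have "c e \<le> (\<Sum>x | p x = p e. c x)" by (intro member_le_sum) auto
        then show False using p[OF c(1), of "p e"] c(3) by simp
      qed
      then obtain f where f: "p f = p e" "c f < 0" by blast
      then have "f \<noteq> e" using c(3) by auto
      then have fT: "f \<in> T" "f \<noteq> e" using c(2)[of f] f(2) by auto
      define T' where "T' = insert e T - {f}"
      have T': "primal_tree T'"
      proof -
        have "spans UNIV t h T'" unfolding T'_def
          using c(1,2) f(2) by (intro spans_exchange[OF Tsp, of c]) auto
        moreover have "card T' = card T" unfolding T'_def using eT(1) fT by (simp add: card_insert_if)
        ultimately show ?thesis
          using less.prems cut_tree_iff_spans_card[OF primal_ends finite[of T]]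
            cut_tree_iff_spans_card[OF primal_ends finite[of T']] by simp
      qed
      have wA: "w (dh x) = w (dt x)" if "x \<in> - T" "x \<noteq> e" for x
        using w[of x] c(2)[of x] that by auto
      have "S T \<subseteq> {v. w v = w r}" unfolding S_def
      proof (rule forward_least)
        fix x assume "x \<in> - T" "dt x \<in> {v. w v = w r}" "dt x \<in> forward r (- T)"
        then show "dh x \<in> {v. w v = w r}" using wA[of x] eT(3) unfolding S_def by auto
      qed simp
      then have wS: "w v = w r" if "v \<in> S T" for v using that by blast
      have we: "w (dh e) = w r" "w (dt e) = w r - 1" using wS[OF eT(2)] w[of e] c(3) by auto
      \<comment> \<open>Among the arcs of the spanning set \<open>- T\<close> only \<open>e\<close>
        changes \<open>w\<close>, so \<open>w r\<close> and \<open>w r - 1\<close> are its only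
        values. As \<open>c f < 0\<close>, the arc \<open>f\<close> must lead from the first value
        to the second, away from the side of \<open>r\<close>.\<close>
      have "closed_under dt dh (- T) {v\<in>R. w v = w r \<or> w v = w r - 1}"
        unfolding closed_under_def
      proof
        fix x assume x: "x \<in> - T"
        have "dt x \<in> R" "dh x \<in> R" using range_dt range_dh by auto
        then show "dt x \<in> {v\<in>R. w v = w r \<or> w v = w r - 1} \<longleftrightarrow> dh x \<in> {v\<in>R. w v = w r \<or> w v = w r - 1}"
          using wA[OF x] we by (cases "x = e") auto
      qed
      then have "{v\<in>R. w v = w r \<or> w v = w r - 1} = R"
        using Asp r unfolding spans_def by (metis (mono_tags, lifting) empty_iff mem_Collect_eq subsetI)
      then have "w (dh f) = w r \<or> w (dh f) = w r - 1" "w (dt f) = w r \<or> w (dt f) = w r - 1"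
        using range_dh range_dt by blast+
      then have "w (dh f) = w r - 1" using w[of f] f(2) by auto
      then have fS: "dh f \<notin> S T" using wS[of "dh f"] by auto
      have SS: "S T \<subseteq> S T'" unfolding S_def[of T]
      proof (rule forward_least)
        show "r \<in> S T'" unfolding S_def by (rule forward_root)
        fix x assume x: "x \<in> - T" "dt x \<in> S T'" "dt x \<in> forward r (- T)"
        then have "x \<noteq> e" using eT(3) unfolding S_def by blast
        then have "x \<in> - T'" using x(1) unfolding T'_def by blast
        then show "dh x \<in> S T'" using x(2) forward_step unfolding S_def by blast
      qed
      have S'R: "S T' \<subseteq> R" unfolding S_def by (rule forward_subset[OF r])
      have "(T', T) \<in> ?m"
      proof (cases "S T' = S T")
        case True
        have "B T' \<subseteq> B T - {e}"
          using True fS eT(1) fT unfolding B_def T'_def by auto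
        then have "B T' \<subset> B T" using e by blast
        then have "card (B T') < card (B T)" by (intro psubset_card_mono) auto
        then show ?thesis using True by simp
      next
        case False
        then have "S T \<subset> S T'" using SS by blast
        then have "card (S T) < card (S T')" "card (S T') \<le> card R"
          using psubset_card_mono[OF finite_subset[OF S'R finite_R]] card_mono[OF finite_R S'R] by auto
        then have "card R - card (S T') < card R - card (S T)" by linarith
        then show ?thesis by simp
      qed
      then obtain T'' where T'': "primal_tree T''" "\<And>a. card {e\<in>T''. p e = a} = card {e\<in>T'. p e = a}"
        "rooted_at R dt dh r (- T'')"
        using less.IH[OF _ T'] by blast
      have "card {x\<in>T'. p x = a} = card {x\<in>T. p x = a}" for a
      proof (cases "a = p e")
        case True
        have "{x\<in>T'. p x = a} = insert e {x\<in>T. p x = a} - {f}"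
          unfolding T'_def using True by auto
        then show ?thesis using True f fT eT(1) by (simp add: card_insert_if)
      next
        case False
        then have "{x\<in>T'. p x = a} = {x\<in>T. p x = a}" unfolding T'_def using f by auto
        then show ?thesis by simp
      qed
      then show ?thesis using T'' by metis
    qed
  qed
qed

end

text \<open>All edges run from left to right, so all terms at one vertex carry the same sign. The
  resulting condition is symmetric in \<open>p\<close> and \<open>q\<close>, which lets the color
  classes be swapped while the dual arcs stay as they are.\<close>

lemma Inl_Inr_boundary_zero_iff:
  "(\<forall>v. boundary (\<lambda>e. Inl (p e)) (\<lambda>e. Inr (q e)) c v = 0) \<longleftrightarrow>
    (\<forall>a. (\<Sum>e | p e = a. c e) = 0) \<and> (\<forall>b. (\<Sum>e | q e = b. c e) = 0)"
proof -
  have "boundary (\<lambda>e. Inl (p e)) (\<lambda>e. Inr (q e)) c (Inl a) = - (\<Sum>e | p e = a. c e)" for a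
    unfolding boundary_def sum_negf[symmetric] by (intro sum.mono_neutral_cong_right) auto
  moreover have "boundary (\<lambda>e. Inl (p e)) (\<lambda>e. Inr (q e)) c (Inr b) = (\<Sum>e | q e = b. c e)" for b
    unfolding boundary_def by (intro sum.mono_neutral_cong_right) auto
  ultimately show ?thesis by (metis neg_equal_0_iff_equal obj_sumE)
qed

text \<open>Take the ancestors of an element with the fewest ancestors. Each of them has the same
  ancestor set, so they are mutually reachable: a source component.\<close>

lemma finite_preorder_minimal:
  fixes rel :: "('x::finite \<times> 'x) set"
  obtains C where "C \<noteq> {}" "\<And>u v. (u, v) \<in> rel \<Longrightarrow> v \<in> C \<Longrightarrow> u \<in> C"
    "\<And>u v. u \<in> C \<Longrightarrow> v \<in> C \<Longrightarrow> (u, v) \<in> rel\<^sup>*"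
proof -
  let ?P = "\<lambda>v. {u. (u, v) \<in> rel\<^sup>*}"
  obtain v where v: "\<And>x. card (?P v) \<le> card (?P x)"
    using ex_has_least_nat[of "\<lambda>_. True" undefined "\<lambda>v. card (?P v)"] by blast
  show thesis
  proof (rule that[of "?P v"])
    show "?P v \<noteq> {}" by blast
    show "u \<in> ?P v" if "(u, x) \<in> rel" "x \<in> ?P v" for u x
      using that by (auto intro: converse_rtrancl_into_rtrancl)
    show "(u, x) \<in> rel\<^sup>*" if "u \<in> ?P v" "x \<in> ?P v" for u x
    proof -
      have "?P x \<subseteq> ?P v" using that(2) by auto
      then have "?P x = ?P v" using v[of x] by (intro card_seteq) auto
      then show ?thesis using that(1) by blast
    qed
  qed
qed

locale bipartite_dual = planar_dual "\<lambda>e. Inl (p e)" "\<lambda>e. Inr (q e)" R dt dh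
  for p :: "'e::finite \<Rightarrow> 'a::finite" and q :: "'e \<Rightarrow> 'b::finite" and R :: "'r set" and dt dh
begin

lemma swap: "bipartite_dual q p R dt dh"
proof
  show "spans UNIV (\<lambda>e. Inl (q e)) (\<lambda>e. Inr (p e)) UNIV"
    by (rule spans_Inl_Inr_swap[OF spans_UNIV])
  show "\<exists>w. \<forall>e. w (dh e) - w (dt e) = c e"
    if "\<And>v. boundary (\<lambda>e. Inl (q e)) (\<lambda>e. Inr (p e)) c v = 0" for c
    using that by (intro potential) (metis Inl_Inr_boundary_zero_iff)
  show "card R + card (UNIV :: ('b + 'a) set) \<le> card (UNIV :: 'e set) + 2"
    using euler by (simp add: card_UNIV_sum add.commute)
qed (use dual_ends in auto)

text \<open>Orient the edges of \<open>T\<close> from left to right and those of \<open>T'\<close> from right to left.  A directed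
  cycle through an edge in which \<open>T\<close> and \<open>T'\<close> differ yields a potential that is weakly decreasing along
  the arborescence \<open>- T\<close> and weakly increasing along \<open>- T'\<close>, hence constant.  Without such a cycle a
  source component is a union of components of \<open>T\<close>, by equality of the left degrees.\<close>
lemma rooted_trees_eq:
  assumes r: "r \<in> R" and T: "primal_tree T" "rooted_at R dt dh r (- T)"
    and T': "primal_tree T'" "rooted_at R dt dh r (- T')"
    and deg: "\<And>a. card {e\<in>T. p e = a} = card {e\<in>T'. p e = a}"
  shows "T = T'"
proof -
  define rel where "rel = {(Inl (p e), Inr (q e) :: 'a + 'b) | e. e \<in> T} \<union> {(Inr (q e), Inl (p e)) | e. e \<in> T'}"
  \<comment> \<open>The chain of a directed walk in \<open>rel\<close>: a step along
    \<open>T\<close> adds 1, a step back along \<open>T'\<close> subtracts 1. So positive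
    coefficients occur only on \<open>T\<close> and negative ones only on \<open>T'\<close>.\<close>
  define P where "P u v c \<longleftrightarrow> (\<forall>x. boundary (\<lambda>e. Inl (p e)) (\<lambda>e. Inr (q e)) c x = of_bool (x = v) - of_bool (x = u))
     \<and> (\<forall>e. (e \<notin> T \<longrightarrow> c e \<le> 0) \<and> (e \<notin> T' \<longrightarrow> (0::real) \<le> c e))" for u v c
  have chain: "\<exists>c. P u v c" if "(u, v) \<in> rel\<^sup>*" for u v
    using that
  proof (induction rule: rtrancl_induct)
    case base
    have "P u u (\<lambda>_. 0)" unfolding P_def by (simp add: boundary_def)
    then show ?case by blast
  next
    case (step x y)
    then obtain c where c: "P u x c" by blast
    from step(2) obtain e and k :: real where e: "(k = 1 \<and> e \<in> T \<and> x = Inl (p e) \<and> y = Inr (q e)) \<or>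
        (k = - 1 \<and> e \<in> T' \<and> x = Inr (q e) \<and> y = Inl (p e))"
      unfolding rel_def by blast
    have "P u y (\<lambda>z. c z + k * of_bool (z = e))"
      unfolding P_def
    proof (intro conjI allI impI)
      show "boundary (\<lambda>e. Inl (p e)) (\<lambda>e. Inr (q e)) (\<lambda>z. c z + k * of_bool (z = e)) v
          = of_bool (v = y) - of_bool (v = u)" for v
      proof -
        have "boundary (\<lambda>e. Inl (p e)) (\<lambda>e. Inr (q e)) c v = of_bool (v = x) - of_bool (v = u)"
          using c unfolding P_def by blast
        then show ?thesis
          unfolding boundary_add boundary_single using e by (elim disjE conjE) (simp_all add: eq_commute[of v])
      qed
      show "c z + k * of_bool (z = e) \<le> 0" if "z \<notin> T" for z
        using c e that unfolding P_def by (cases "z = e") auto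
      show "0 \<le> c z + k * of_bool (z = e)" if "z \<notin> T'" for z
        using c e that unfolding P_def by (cases "z = e") auto
    qed
    then show ?case by blast
  qed
  have no_cycle: False if "P u v c" "(e \<in> T - T' \<and> u = Inr (q e) \<and> v = Inl (p e)) \<or> (e \<in> T' - T \<and> u = Inl (p e) \<and> v = Inr (q e))"
    for u v c e
  proof -
    \<comment> \<open>The edge \<open>e\<close> closes the walk, forwards if it is in
      \<open>T\<close> and backwards otherwise. Since it lies in only one of the two trees,
      \<open>c e\<close> cannot have the sign opposite to \<open>k\<close>, and the coefficient of
      \<open>e\<close> stays nonzero.\<close>
    define k :: real where "k = (if e \<in> T then 1 else - 1)"
    let ?c = "\<lambda>z. c z + k * of_bool (z = e)"
    have 0: "boundary (\<lambda>e. Inl (p e)) (\<lambda>e. Inr (q e)) ?c x = 0" for x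
      using that unfolding P_def boundary_add boundary_single k_def by auto
    obtain w where w: "\<And>z. w (dh z) - w (dt z) = ?c z" using potential[of ?c, OF 0] by blast
    have sgn: "z \<notin> T \<Longrightarrow> ?c z \<le> 0" "z \<notin> T' \<Longrightarrow> 0 \<le> ?c z" for z
      using that unfolding P_def k_def by (auto simp: add_nonpos_nonpos)
    have ends: "dt z \<in> R" "dh z \<in> R" for z using range_dt range_dh by auto
    have "dh z \<in> {v\<in>R. w v \<le> w r}" if "z \<in> - T" "dt z \<in> {v\<in>R. w v \<le> w r}" for z
      using that sgn(1)[of z] w[of z] ends[of z] by auto
    moreover have "{v\<in>R. w v \<le> w r} \<subseteq> R" "r \<in> {v\<in>R. w v \<le> w r}" using r by auto
    ultimately have le: "{v\<in>R. w v \<le> w r} = R"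
      using T(2) unfolding rooted_at_def by blast
    have "dh z \<in> {v\<in>R. w r \<le> w v}" if "z \<in> - T'" "dt z \<in> {v\<in>R. w r \<le> w v}" for z
      using that sgn(2)[of z] w[of z] ends[of z] by auto
    moreover have "{v\<in>R. w r \<le> w v} \<subseteq> R" "r \<in> {v\<in>R. w r \<le> w v}" using r by auto
    ultimately have ge: "{v\<in>R. w r \<le> w v} = R"
      using T'(2) unfolding rooted_at_def by blast
    have "w v = w r" if "v \<in> R" for v
    proof -
      have "v \<in> {v\<in>R. w v \<le> w r}" "v \<in> {v\<in>R. w r \<le> w v}" using le ge that by auto
      then show ?thesis by simp
    qed
    then have "?c e = 0" using w[of e] ends[of e] by simp
    moreover have "?c e \<noteq> 0"
    proof (cases "e \<in> T")
      case True
      then have "0 \<le> c e" using that unfolding P_def by blast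
      then show ?thesis using True by (simp add: k_def)
    next
      case False
      then have "c e \<le> 0" using that unfolding P_def by blast
      then show ?thesis using False by (simp add: k_def)
    qed
    ultimately show False by simp
  qed
  obtain C where C: "C \<noteq> {}" "\<And>u v. (u, v) \<in> rel \<Longrightarrow> v \<in> C \<Longrightarrow> u \<in> C"
    "\<And>u v. u \<in> C \<Longrightarrow> v \<in> C \<Longrightarrow> (u, v) \<in> rel\<^sup>*"
    using finite_preorder_minimal[of rel] by metis
  have inside: "e \<in> T \<longleftrightarrow> e \<in> T'" if "Inl (p e) \<in> C" "Inr (q e) \<in> C" for e
    using chain[OF C(3)] no_cycle that by (metis DiffI)
  have TC: "Inl (p e) \<in> C" if "e \<in> T" "Inr (q e) \<in> C" for e
    using C(2) that unfolding rel_def by blast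
  have T'C: "Inr (q e) \<in> C" if "e \<in> T'" "Inl (p e) \<in> C" for e
    using C(2) that unfolding rel_def by blast
  \<comment> \<open>At a left vertex of \<open>C\<close> every edge of \<open>T'\<close> stays in
    \<open>C\<close> and so belongs to \<open>T\<close>. Equality of the degrees makes these all the
    edges of \<open>T\<close> there.\<close>
  have TC': "Inr (q e) \<in> C" if e: "e \<in> T" "Inl (p e) \<in> C" for e
  proof -
    have "{x\<in>T'. p x = p e} \<subseteq> {x\<in>T. p x = p e}" using T'C inside e(2) by auto
    then have "{x\<in>T'. p x = p e} = {x\<in>T. p x = p e}"
      using deg[of "p e"] by (intro card_subset_eq) auto
    then have "e \<in> T'" using e(1) by blast
    then show ?thesis using T'C e(2) by blast
  qed
  have "closed_under (\<lambda>e. Inl (p e)) (\<lambda>e. Inr (q e)) T C"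
    using TC TC' unfolding closed_under_def by blast
  then have "C = UNIV" using T(1) C(1) unfolding cut_tree_def spans_def by blast
  then show "T = T'" using inside by blast
qed

section \<open>Counting arborescences by degree vectors\<close>

definition degree_vectors :: "('a \<Rightarrow> nat) set" where
  "degree_vectors = {f. \<exists>T. primal_tree T \<and> (\<forall>x. card {e\<in>T. p e = x} = f x + 1)}"

text \<open>A left vertex missed by \<open>T\<close> would be a closed set of its own, yet there is
  a right vertex besides it. This makes the truncated subtraction of 1 from the degrees
  exact.\<close>

lemma degree_pos:
  assumes "primal_tree T"
  shows "0 < card {e\<in>T. p e = a}"
proof (rule ccontr)
  assume "\<not> ?thesis"
  then have "closed_under (\<lambda>e. Inl (p e)) (\<lambda>e. Inr (q e)) T {Inl a}"
    by (auto simp: closed_under_def)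
  then have "{Inl a} = (UNIV :: ('a + 'b) set)" using assms unfolding cut_tree_def spans_def by blast
  then show False by (metis Inl_Inr_False UNIV_I singletonD)
qed

theorem card_rooted_dual_trees:
  assumes r: "r \<in> R"
  shows "card {A. dual_tree A \<and> rooted_at R dt dh r A} = card degree_vectors"
proof -
  let ?f = "\<lambda>A a. card {e \<in> - A. p e = a} - 1"
  have deg: "card {e \<in> - A. p e = a} = ?f A a + 1" if "dual_tree A" for A a
    using degree_pos[OF primal_tree_Compl[OF that], of a] by simp
  have "bij_betw ?f {A. dual_tree A \<and> rooted_at R dt dh r A} degree_vectors"
    unfolding bij_betw_def
  proof
    show "inj_on ?f {A. dual_tree A \<and> rooted_at R dt dh r A}"
    proof (rule inj_onI)
      fix A B assume A: "A \<in> {A. dual_tree A \<and> rooted_at R dt dh r A}"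
        and B: "B \<in> {A. dual_tree A \<and> rooted_at R dt dh r A}" and eq: "?f A = ?f B"
      have "- A = - B"
      proof (rule rooted_trees_eq[OF r])
        show "card {e \<in> - A. p e = a} = card {e \<in> - B. p e = a}" for a
          using deg[of A a] deg[of B a] A B fun_cong[OF eq, of a] by simp
      qed (use A B primal_tree_Compl in auto)
      then show "A = B" by simp
    qed
    show "?f ` {A. dual_tree A \<and> rooted_at R dt dh r A} = degree_vectors"
    proof (intro equalityI subsetI)
      fix f assume "f \<in> ?f ` {A. dual_tree A \<and> rooted_at R dt dh r A}"
      then obtain A where A: "dual_tree A" "f = ?f A" by blast
      show "f \<in> degree_vectors"
        unfolding degree_vectors_def A(2) using primal_tree_Compl[OF A(1)] deg[OF A(1)] by blast
    next
      fix f assume "f \<in> degree_vectors"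
      then obtain T where T: "primal_tree T" "\<And>x. card {e\<in>T. p e = x} = f x + 1"
        unfolding degree_vectors_def by blast
      have "(\<Sum>e | p e = a. c e) = 0" if "\<And>v. boundary (\<lambda>e. Inl (p e)) (\<lambda>e. Inr (q e)) c v = 0" for c a
        using that Inl_Inr_boundary_zero_iff by metis
      from ex_rooted_tree[of p r T, OF this r T(1)]
      obtain T' where T': "primal_tree T'" "\<And>x. card {e\<in>T'. p e = x} = f x + 1"
        "rooted_at R dt dh r (- T')"
        unfolding T(2) by blast
      have "f = ?f (- T')" using T'(2) by (intro ext) simp
      then show "f \<in> ?f ` {A. dual_tree A \<and> rooted_at R dt dh r A}"
        using T'(3) dual_tree_Compl(1)[OF T'(1)] by blast
    qed
  qed
  then show ?thesis by (rule bij_betw_same_card)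
qed

end

section \<open>Walks, spanning trees and arborescences\<close>

lemma connected_iff_spans:
  assumes "range (tail G) \<subseteq> verts G" "range (head G) \<subseteq> verts G"
  shows "Digraph_Component.connected (G\<lparr>arcs := T\<rparr>) \<longleftrightarrow>
    verts G \<noteq> {} \<and> spans (verts G) (tail G) (head G) T"
proof -
  let ?V = "verts G" and ?r = "(arcs_ends (G\<lparr>arcs := T\<rparr>))\<^sup>s"
  have ends: "tail G e \<in> ?V" "head G e \<in> ?V" for e using assms by auto
  have r: "(x, y) \<in> ?r \<longleftrightarrow> (\<exists>e\<in>T. (x = tail G e \<and> y = head G e) \<or> (x = head G e \<and> y = tail G e))" for x y
    by (auto simp: symcl_def arcs_ends_def arc_to_ends_def)
  have "(\<forall>u\<in>?V. \<forall>v\<in>?V. (u, v) \<in> rtrancl_on ?V ?r) \<longleftrightarrow> spans ?V (tail G) (head G) T"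
  proof
    assume L: "\<forall>u\<in>?V. \<forall>v\<in>?V. (u, v) \<in> rtrancl_on ?V ?r"
    show "spans ?V (tail G) (head G) T"
      unfolding spans_def
    proof (intro allI impI)
      fix X assume X: "X \<subseteq> ?V" "closed_under (tail G) (head G) T X"
      have "v \<in> X" if "(u, v) \<in> rtrancl_on ?V ?r" "u \<in> X" for u v
        using that
      proof (induction rule: rtrancl_on.induct)
        case (rtrancl_on_into_rtrancl_on a b c)
        then show ?case using X(2) unfolding r closed_under_def by auto
      qed
      then show "X = {} \<or> X = ?V" using L X(1) by blast
    qed
  next
    assume R: "spans ?V (tail G) (head G) T"
    show "\<forall>u\<in>?V. \<forall>v\<in>?V. (u, v) \<in> rtrancl_on ?V ?r"
    proof (intro ballI)
      fix u v assume uv: "u \<in> ?V" "v \<in> ?V"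
      let ?X = "{v \<in> ?V. (u, v) \<in> rtrancl_on ?V ?r}"
      have step: "y \<in> ?X" if "x \<in> ?X" "(x, y) \<in> ?r" "y \<in> ?V" for x y
        using that rtrancl_on_into_rtrancl_on[of u x ?V ?r y] by blast
      have "closed_under (tail G) (head G) T ?X"
        unfolding closed_under_def
      proof
        fix e assume "e \<in> T"
        then have "(tail G e, head G e) \<in> ?r" "(head G e, tail G e) \<in> ?r" using r by blast+
        then show "tail G e \<in> ?X \<longleftrightarrow> head G e \<in> ?X" using step ends by meson
      qed
      moreover have "u \<in> ?X" using uv(1) by auto
      moreover have "?X \<subseteq> ?V" by blast
      ultimately have "?X = ?V" using R unfolding spans_def by blast
      then show "(u, v) \<in> rtrancl_on ?V ?r" using uv(2) by blast
    qed
  qed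
  then show ?thesis unfolding connected_conv by simp
qed

abbreviation walks_in :: "('v,'e) pre_digraph \<Rightarrow> 'e set \<Rightarrow> ('v, 'e \<times> bool) pre_digraph" where
  "walks_in G T \<equiv> both_ways (G\<lparr>arcs := T\<rparr>)"

lemma walks_in_simps [simp]:
  "verts (walks_in G T) = verts G" "arcs (walks_in G T) = T \<times> UNIV"
  "tail (walks_in G T) (e, b) = (if b then tail G e else head G e)"
  "head (walks_in G T) (e, b) = (if b then head G e else tail G e)"
  by (auto simp: both_ways_def)

lemma walks_in_wf:
  assumes "range (tail G) \<subseteq> verts G" "range (head G) \<subseteq> verts G"
  shows "wf_digraph (walks_in G T)"
  using assms by unfold_locales (auto simp: image_subset_iff)

lemma walks_in_cas_cong:
  "pre_digraph.cas (walks_in G S) u p v \<longleftrightarrow> pre_digraph.cas (walks_in G T) u p v"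
proof (induction p arbitrary: u)
  case (Cons a p)
  then show ?case by (cases a) (simp add: pre_digraph.cas.simps)
qed (simp add: pre_digraph.cas.simps)

lemma walks_in_verts_cong:
  "pre_digraph.awalk_verts (walks_in G S) u p = pre_digraph.awalk_verts (walks_in G T) u p"
proof (induction p arbitrary: u)
  case (Cons a p)
  then show ?case by (cases a) (simp add: pre_digraph.awalk_verts.simps)
qed (simp add: pre_digraph.awalk_verts.simps)

lemma walk_closed_under:
  assumes "pre_digraph.cas (walks_in G T) u p v" "closed_under (tail G) (head G) S X" "fst ` set p \<subseteq> S"
  shows "u \<in> X \<longleftrightarrow> v \<in> X"
  using assms(1,3)
proof (induction p arbitrary: u)
  case (Cons a p)
  obtain e b where a: "a = (e, b)" by fastforce
  have "tail G e \<in> X \<longleftrightarrow> head G e \<in> X"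
    using assms(2) Cons.prems(2) a unfolding closed_under_def by simp
  then show ?case using Cons a by (auto simp: pre_digraph.cas.simps split: if_splits)
qed (simp add: pre_digraph.cas.simps)

text \<open>If the first edge occurred again, in either direction, both its endpoints would be among
  the later vertices; but one of them is the start, which is not revisited.\<close>

lemma apath_distinct_edges:
  assumes "wf_digraph (walks_in G T)" "pre_digraph.apath (walks_in G T) u p v"
  shows "distinct (map fst p)"
  using assms(2)
proof (induction p arbitrary: u)
  case (Cons a p)
  interpret wf_digraph "walks_in G T" by fact
  obtain e b where a: "a = (e, b)" by fastforce
  have tl: "apath (head (walks_in G T) a) p v"
    "u \<notin> set (awalk_verts (head (walks_in G T) a) p)" "u = tail (walks_in G T) a"
    using Cons.prems by (auto simp: apath_Cons_iff)
  have "e \<notin> fst ` set p"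
  proof
    assume "e \<in> fst ` set p"
    then obtain b' where b': "(e, b') \<in> set p" by auto
    then have "tail (walks_in G T) (e, b') \<in> set (awalk_verts (head (walks_in G T) a) p)"
      "head (walks_in G T) (e, b') \<in> set (awalk_verts (head (walks_in G T) a) p)"
      using awalk_verts_arc1 awalk_verts_arc2 tl(1) unfolding apath_def by blast+
    then show False using tl(2,3) a by (cases b; cases b') auto
  qed
  then show ?case using Cons.IH[OF tl(1)] a by simp
qed simp

lemma reachable_closed_under:
  assumes "wf_digraph (walks_in G T)" "range (tail G) \<subseteq> verts G" "range (head G) \<subseteq> verts G"
  shows "closed_under (tail G) (head G) T {v. \<exists>p. pre_digraph.apath (walks_in G T) u p v}"
proof -
  interpret wf_digraph "walks_in G T" by fact
  have 1: "u \<rightarrow>\<^sup>*\<^bsub>walks_in G T\<^esub> head (walks_in G T) (e, b)" if "u \<rightarrow>\<^sup>*\<^bsub>walks_in G T\<^esub> tail (walks_in G T) (e, b)" "e \<in> T" for e b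
  proof (rule reachable_adj_trans[OF that(1)])
    show "tail (walks_in G T) (e, b) \<rightarrow>\<^bsub>walks_in G T\<^esub> head (walks_in G T) (e, b)"
      using that(2) by (intro in_arcs_imp_in_arcs_ends) simp
  qed
  show ?thesis
    unfolding closed_under_def reachable_apath[symmetric]
    using 1[of _ True] 1[of _ False] by auto
qed

text \<open>If \<open>e\<close> is not a bridge, a path from its head to its tail that avoids
  \<open>e\<close> closes up to a cycle with \<open>e\<close>. Conversely, the rest of a cycle
  through \<open>e\<close> would have to cross back over a cut that only \<open>e\<close>
  crosses.\<close>

lemma no_undirected_cycle_iff:
  assumes "range (tail G) \<subseteq> verts G" "range (head G) \<subseteq> verts G"
  shows "(\<nexists>p. undirected_cycle (G\<lparr>arcs := T\<rparr>) p) \<longleftrightarrow> all_bridges (tail G) (head G) T"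
proof
  assume no: "\<nexists>p. undirected_cycle (G\<lparr>arcs := T\<rparr>) p"
  interpret wf_digraph "walks_in G T" by (rule walks_in_wf[OF assms])
  show "all_bridges (tail G) (head G) T"
    unfolding all_bridges_def
  proof
    fix e assume e: "e \<in> T"
    let ?W = "walks_in G (T - {e})"
    interpret W: wf_digraph ?W by (rule walks_in_wf[OF assms])
    let ?X = "{v. \<exists>p. W.apath (head G e) p v}"
    have cl: "closed_under (tail G) (head G) (T - {e}) ?X"
      by (rule reachable_closed_under[OF W.wf_digraph assms])
    have hX: "head G e \<in> ?X"
      using assms by (auto intro!: exI[of _ "[]"] simp: W.apath_Nil_iff image_subset_iff)
    have "tail G e \<notin> ?X"
    proof
      assume "tail G e \<in> ?X"
      then obtain q where q: "W.apath (head G e) q (tail G e)" by blast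
      have "undirected_cycle (G\<lparr>arcs := T\<rparr>) ((e, True) # q)"
        unfolding undirected_cycle_def
      proof
        have "cas (head G e) q (tail G e)" "set q \<subseteq> (T - {e}) \<times> UNIV"
          "distinct (awalk_verts (head G e) q)"
          using q walks_in_cas_cong[of "T - {e}" G _ q _ T] walks_in_verts_cong[of "T - {e}" G _ q T]
          unfolding W.apath_def W.awalk_def by auto
        then show "cycle ((e, True) # q)"
          unfolding cycle_def awalk_def using e assms
          by (intro exI[of _ "tail G e"]) (auto simp: image_subset_iff)
        have "e \<notin> fst ` set q" using \<open>set q \<subseteq> (T - {e}) \<times> UNIV\<close> by auto
        then show "distinct (map fst ((e, True) # q))"
          using apath_distinct_edges[OF W.wf_digraph q] by simp
      qed
      then show False using no by blast
    qed
    then show "\<exists>X. (tail G e \<in> X \<longleftrightarrow> head G e \<notin> X) \<and> closed_under (tail G) (head G) (T - {e}) X"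
      using cl hX by (intro exI[of _ ?X] conjI) (simp_all only: simp_thms)
  qed
next
  assume br: "all_bridges (tail G) (head G) T"
  show "\<nexists>p. undirected_cycle (G\<lparr>arcs := T\<rparr>) p"
  proof
    assume "\<exists>p. undirected_cycle (G\<lparr>arcs := T\<rparr>) p"
    then obtain p u where p: "pre_digraph.awalk (walks_in G T) u p u" "p \<noteq> []" "distinct (map fst p)"
      unfolding undirected_cycle_def pre_digraph.cycle_def by blast
    then obtain e b p' where p': "p = (e, b) # p'" by (cases p) auto
    have cas: "tail (walks_in G T) (e, b) = u" "pre_digraph.cas (walks_in G T) (head (walks_in G T) (e, b)) p' u"
      and T: "e \<in> T" "fst ` set p' \<subseteq> T"
      using p(1) unfolding p' pre_digraph.awalk_def by (auto simp: pre_digraph.cas.simps)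
    obtain X where X: "tail G e \<in> X \<longleftrightarrow> head G e \<notin> X" "closed_under (tail G) (head G) (T - {e}) X"
      using br T(1) unfolding all_bridges_def by blast
    have "fst ` set p' \<subseteq> T - {e}" using T(2) p(3) unfolding p' by auto
    then have "head (walks_in G T) (e, b) \<in> X \<longleftrightarrow> tail (walks_in G T) (e, b) \<in> X"
      using walk_closed_under[OF cas(2) X(2)] cas(1) by simp
    then show False using X(1) by (cases b) simp_all
  qed
qed

lemma is_spanning_tree_iff:
  assumes "range (tail G) \<subseteq> verts G" "range (head G) \<subseteq> verts G" "verts G \<noteq> {}" "arcs G = UNIV"
  shows "is_spanning_tree G T \<longleftrightarrow> cut_tree (verts G) (tail G) (head G) T"
  unfolding is_spanning_tree_def cut_tree_def connected_iff_spans[OF assms(1,2)]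
    no_undirected_cycle_iff[OF assms(1,2)] using assms by simp

lemma forward_walk_closed:
  assumes "pre_digraph.cas (walks_in G T) u p v" "\<forall>(e, fwd) \<in> set p. fwd" "u \<in> X"
    "\<And>e. e \<in> fst ` set p \<Longrightarrow> tail G e \<in> X \<Longrightarrow> head G e \<in> X"
  shows "v \<in> X"
  using assms
proof (induction p arbitrary: u)
  case (Cons a p)
  then show ?case by (cases a) (auto simp: pre_digraph.cas.simps)
qed (simp add: pre_digraph.cas.simps)

text \<open>To derive forward paths from \<open>rooted_at\<close>, take the first backward arc
  \<open>(e, False)\<close> of a path. The part before it avoids \<open>e\<close>, as a path uses no
  edge twice, so \<open>r\<close> is on the side of the head of \<open>e\<close> in the cut crossed
  only by \<open>e\<close>. No arc of \<open>T\<close> leaves this side, against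
  \<open>rooted_at\<close>.\<close>

lemma is_spanning_arborescence_iff:
  assumes ends: "range (tail G) \<subseteq> verts G" "range (head G) \<subseteq> verts G" and G: "arcs G = UNIV" and r: "r \<in> verts G"
  shows "is_spanning_arborescence G r T \<longleftrightarrow>
    cut_tree (verts G) (tail G) (head G) T \<and> rooted_at (verts G) (tail G) (head G) r T"
proof -
  interpret wf_digraph "walks_in G T" by (rule walks_in_wf[OF ends])
  have ne: "verts G \<noteq> {}" using r by blast
  have "(\<forall>v\<in>verts G. \<forall>p. apath r p v \<longrightarrow> (\<forall>(e, fwd)\<in>set p. fwd)) \<longleftrightarrow>
      rooted_at (verts G) (tail G) (head G) r T" (is "?L \<longleftrightarrow> ?R")
    if T: "cut_tree (verts G) (tail G) (head G) T"
  proof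
    assume L: ?L
    show ?R
      unfolding rooted_at_def
    proof (intro allI impI)
      fix X assume X: "X \<subseteq> verts G" "r \<in> X" "\<forall>e\<in>T. tail G e \<in> X \<longrightarrow> head G e \<in> X"
      let ?Y = "{v. \<exists>p. apath r p v}"
      have "closed_under (tail G) (head G) T ?Y"
        by (rule reachable_closed_under[OF wf_digraph ends])
      moreover have "?Y \<subseteq> verts G"
        unfolding apath_def using awalk_last_in_verts by auto
      moreover have "r \<in> ?Y" using r by (auto intro!: exI[of _ "[]"] simp: apath_Nil_iff)
      ultimately have Y: "?Y = verts G" using T unfolding cut_tree_def spans_def by blast
      have "v \<in> X" if v: "v \<in> verts G" for v
      proof -
        obtain p where p: "apath r p v" using v Y by blast
        show ?thesis
        proof (rule forward_walk_closed)
          show "cas r p v" using p unfolding apath_def awalk_def by blast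
          show "\<forall>(e, fwd)\<in>set p. fwd" using L v p by blast
          show "r \<in> X" by fact
          fix e assume "e \<in> fst ` set p" "tail G e \<in> X"
          moreover have "fst ` set p \<subseteq> T" using p unfolding apath_def awalk_def by auto
          ultimately show "head G e \<in> X" using X(3) by blast
        qed
      qed
      then show "X = verts G" using X(1) by blast
    qed
  next
    assume R: ?R
    have False if p: "apath r p v" and bwd: "\<not> (\<forall>(e, fwd)\<in>set p. fwd)" for p v
    proof -
      have "\<exists>x\<in>set p. \<not> snd x" using bwd by force
      then obtain p1 a p2 where split: "p = p1 @ a # p2" "\<not> snd a" "\<forall>x\<in>set p1. snd x"
        using split_list_first_prop[of p "\<lambda>x. \<not> snd x"] by blast
      obtain e where a: "a = (e, False)" using split(2) by (metis prod.collapse)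
      have w: "awalk r p1 (head G e)" "e \<in> T" "distinct (awalk_verts r (p1 @ a # p2))"
        using p unfolding apath_def split(1) a by (auto simp: awalk_Cons_iff)
      have "e \<notin> fst ` set p1"
      proof
        assume "e \<in> fst ` set p1"
        then have "(e, True) \<in> set p1" using split(3) by force
        then obtain q1 q2 where q: "p1 = q1 @ (e, True) # q2" by (meson split_list)
        then have "p = q1 @ (e, True) # (q2 @ (e, False) # p2)" using split(1) a by simp
        then have "apath (tail G e) ((e, True) # (q2 @ (e, False) # p2)) v"
          using p by (auto simp: apath_def awalk_verts_conv awalk_Cons_iff)
        then have "e \<notin> fst ` set (q2 @ (e, False) # p2)"
          using apath_distinct_edges[OF wf_digraph] by fastforce
        then show False by simp
      qed
      then have p1: "fst ` set p1 \<subseteq> T - {e}" using w(1) unfolding awalk_def by auto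
      obtain X where X: "tail G e \<in> X \<longleftrightarrow> head G e \<notin> X" "closed_under (tail G) (head G) (T - {e}) X"
        using T w(2) unfolding cut_tree_def all_bridges_def by blast
      define Y where "Y = {v \<in> verts G. v \<in> X \<longleftrightarrow> head G e \<in> X}"
      have "r \<in> X \<longleftrightarrow> head G e \<in> X"
        using walk_closed_under[OF _ X(2) p1, of T] w(1) unfolding awalk_def by blast
      then have "r \<in> Y" using r unfolding Y_def by blast
      moreover have "\<forall>x\<in>T. tail G x \<in> Y \<longrightarrow> head G x \<in> Y"
      proof (intro ballI impI)
        fix x assume x: "x \<in> T" "tail G x \<in> Y"
        then have "x \<noteq> e" using X(1) unfolding Y_def by blast
        then show "head G x \<in> Y"
          using x X(2) ends unfolding Y_def closed_under_def by auto
      qed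
      moreover have "Y \<subseteq> verts G" unfolding Y_def by blast
      ultimately have "Y = verts G" using R unfolding rooted_at_def by blast
      then have "tail G e \<in> Y" using ends by auto
      then show False using X(1) unfolding Y_def by blast
    qed
    then show ?L by blast
  qed
  then show ?thesis
    unfolding is_spanning_arborescence_def is_spanning_tree_iff[OF ends ne G] by blast
qed

section \<open>Integer points of the hypertree polytope\<close>

text \<open>Rado's argument: a set with two elements can be shrunk.\<close>
lemma hall_marriage:
  assumes I: "finite I" and fin: "\<And>i. i \<in> I \<Longrightarrow> finite (A i)"
    and hall: "\<And>J. J \<subseteq> I \<Longrightarrow> card J \<le> card (\<Union>i\<in>J. A i)"
  shows "\<exists>f. inj_on f I \<and> (\<forall>i\<in>I. f i \<in> A i)"
  using fin hall
proof (induction "\<Sum>i\<in>I. card (A i)" arbitrary: A rule: less_induct)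
  case less
  have finU: "finite (\<Union>i\<in>J. A i)" if "J \<subseteq> I" for J
    using less.prems(1) that finite_subset[OF that I] by auto
  show ?case
  proof (cases "\<exists>i\<in>I. \<exists>x\<in>A i. \<exists>y\<in>A i. x \<noteq> y")
    case True
    then obtain i x y where i: "i \<in> I" "x \<in> A i" "y \<in> A i" "x \<noteq> y" by blast
    define B where "B z j = A j - (if j = i then {z} else {})" for z j
    have shrink: ?thesis if z: "z \<in> A i" and ok: "\<And>J. J \<subseteq> I \<Longrightarrow> card J \<le> card (\<Union>j\<in>J. B z j)" for z
    proof -
      have "card (B z i) < card (A i)"
        using z less.prems(1)[OF i(1)] unfolding B_def by (simp add: card_Diff1_less del: card_Diff_insert)
      moreover have "card (B z j) \<le> card (A j)" if "j \<in> I" for j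
        unfolding B_def using less.prems(1)[OF that] by (intro card_mono) auto
      ultimately have "(\<Sum>j\<in>I. card (B z j)) < (\<Sum>j\<in>I. card (A j))"
        using I i(1) by (intro sum_strict_mono_ex1) auto
      moreover have "finite (B z j)" if "j \<in> I" for j
        unfolding B_def using less.prems(1)[OF that] by simp
      ultimately have "\<exists>f. inj_on f I \<and> (\<forall>j\<in>I. f j \<in> B z j)"
        using ok by (intro less.hyps)
      then show ?thesis unfolding B_def by blast
    qed
    show ?thesis
    proof (rule ccontr)
      assume no: "\<not> ?thesis"
      \<comment> \<open>A violation of Hall's condition after deleting \<open>z\<close> from
        \<open>A i\<close> must involve \<open>i\<close>. \<open>K\<close> is the violating index
        set without \<open>i\<close>, whence \<open>\<le>\<close> instead of
        \<open><\<close>.\<close>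
      have bad: "\<exists>K\<subseteq>I - {i}. card ((\<Union>j\<in>K. A j) \<union> (A i - {z})) \<le> card K" if z: "z \<in> A i" for z
      proof -
        have "\<not> (\<forall>J. J \<subseteq> I \<longrightarrow> card J \<le> card (\<Union>j\<in>J. B z j))"
          using shrink[OF z] no by blast
        then obtain J where J: "J \<subseteq> I" "card (\<Union>j\<in>J. B z j) < card J"
          by (auto simp: not_le)
        have "i \<in> J"
        proof (rule ccontr)
          assume "i \<notin> J"
          then have "(\<Union>j\<in>J. B z j) = (\<Union>j\<in>J. A j)" unfolding B_def by (intro SUP_cong) auto
          then show False using less.prems(2)[OF J(1)] J(2) by simp
        qed
        then have "J = insert i (J - {i})" by blast
        then have "(\<Union>j\<in>J. B z j) = B z i \<union> (\<Union>j\<in>J - {i}. B z j)" by (metis UN_insert)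
        also have "(\<Union>j\<in>J - {i}. B z j) = (\<Union>j\<in>J - {i}. A j)" unfolding B_def by (intro SUP_cong) auto
        also have "B z i = A i - {z}" unfolding B_def by simp
        finally have "(\<Union>j\<in>J. B z j) = (\<Union>j\<in>J - {i}. A j) \<union> (A i - {z})" by (simp only: Un_commute)
        moreover have "card J = Suc (card (J - {i}))"
          using \<open>i \<in> J\<close> finite_subset[OF J(1) I] by (metis card_Suc_Diff1)
        ultimately show ?thesis using J by (intro exI[of _ "J - {i}"]) auto
      qed
      obtain K L where K: "K \<subseteq> I - {i}" "card ((\<Union>j\<in>K. A j) \<union> (A i - {x})) \<le> card K"
        and L: "L \<subseteq> I - {i}" "card ((\<Union>j\<in>L. A j) \<union> (A i - {y})) \<le> card L"
        using bad[OF i(2)] bad[OF i(3)] by blast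
      let ?P = "(\<Union>j\<in>K. A j) \<union> (A i - {x})" and ?Q = "(\<Union>j\<in>L. A j) \<union> (A i - {y})"
      have finK: "finite K" "finite L" using K(1) L(1) I by (auto intro: finite_subset)
      have finPQ: "finite ?P" "finite ?Q"
        using finU[of K] finU[of L] K(1) L(1) less.prems(1)[OF i(1)] by auto
      \<comment> \<open>Hall's condition holds for \<open>insert i (K \<union> L)\<close>, whose
        sets cover \<open>?P \<union> ?Q\<close> since \<open>x \<noteq> y\<close>, and for
        \<open>K \<inter> L\<close>. The right-hand side is thus at least
        \<open>card K + card L + 1\<close>, too large for the choice of \<open>K\<close> and
        \<open>L\<close>.\<close>
      have "card ?P + card ?Q = card (?P \<union> ?Q) + card (?P \<inter> ?Q)"
        by (rule card_Un_Int[OF finPQ])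
      moreover have "card (insert i (K \<union> L)) \<le> card (?P \<union> ?Q)"
      proof -
        have "?P \<union> ?Q = (\<Union>j\<in>K. A j) \<union> (\<Union>j\<in>L. A j) \<union> A i" using i(4) by blast
        also have "\<dots> = (\<Union>j\<in>insert i (K \<union> L). A j)" by (simp add: UN_Un Un_ac)
        finally show ?thesis using less.prems(2)[of "insert i (K \<union> L)"] K(1) L(1) i(1)
          by (metis Diff_subset Un_least insert_subset order_trans)
      qed
      moreover have "card (K \<inter> L) \<le> card (?P \<inter> ?Q)"
      proof -
        have "card (K \<inter> L) \<le> card (\<Union>j\<in>K \<inter> L. A j)" using K(1) by (intro less.prems(2)) auto
        also have "\<dots> \<le> card (?P \<inter> ?Q)" using finPQ by (intro card_mono) auto
        finally show ?thesis .
      qed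
      moreover have "card (insert i (K \<union> L)) = Suc (card (K \<union> L))"
        using K(1) L(1) finK by (subst card_insert_disjoint) auto
      moreover have "card K + card L = card (K \<union> L) + card (K \<inter> L)"
        by (rule card_Un_Int[OF finK])
      ultimately show False using K(2) L(2) by linarith
    qed
  next
    case False
    have ne: "A i \<noteq> {}" if "i \<in> I" for i
      using less.prems(2)[of "{i}"] that by auto
    define f where "f i = (SOME x. x \<in> A i)" for i
    have f: "f i \<in> A i" if "i \<in> I" for i
      using ne[OF that] unfolding f_def by (simp add: some_in_eq)
    have sing: "A i = {f i}" if "i \<in> I" for i
      using False f[OF that] that by blast
    have "inj_on f I"
    proof (rule inj_onI, rule ccontr)
      fix i j assume ij: "i \<in> I" "j \<in> I" "f i = f j" "i \<noteq> j"
      then have "(\<Union>k\<in>{i, j}. A k) = {f i}" using sing by auto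
      then show False using less.prems(2)[of "{i, j}"] ij by simp
    qed
    then show ?thesis using f by blast
  qed
qed

section \<open>Degree vectors of bipartite trees\<close>

abbreviation bip_tree :: "('e \<Rightarrow> 'a) \<Rightarrow> ('e \<Rightarrow> 'b) \<Rightarrow> 'e set \<Rightarrow> bool" where
  "bip_tree p q \<equiv> cut_tree UNIV (\<lambda>e. Inl (p e)) (\<lambda>e. Inr (q e))"

lemma sum_card_fibres:
  fixes p :: "'e::finite \<Rightarrow> 'a::finite"
  shows "(\<Sum>a\<in>S. card {e\<in>T. p e = a}) = card {e\<in>T. p e \<in> S}"
proof -
  have "card (\<Union>a\<in>S. {e\<in>T. p e = a}) = (\<Sum>a\<in>S. card {e\<in>T. p e = a})"
    by (intro card_UN_disjoint) auto
  moreover have "(\<Union>a\<in>S. {e\<in>T. p e = a}) = {e\<in>T. p e \<in> S}" by auto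
  ultimately show ?thesis by simp
qed

lemma card_bip_tree:
  fixes p :: "'e::finite \<Rightarrow> 'a::finite" and q :: "'e \<Rightarrow> 'b::finite"
  assumes "bip_tree p q T"
  shows "card T + 1 = card (UNIV :: 'a set) + card (UNIV :: 'b set)"
  using assms cut_tree_iff_spans_card[of "UNIV :: ('a + 'b) set" "\<lambda>e. Inl (p e)" "\<lambda>e. Inr (q e)" T]
  by (simp add: card_UNIV_sum)

text \<open>The edges of \<open>T\<close> at \<open>S\<close> form a forest on \<open>S\<close> and
  its neighbors, so their number is less than the number of these vertices. It equals the sum of
  \<open>f\<close> over \<open>S\<close> plus \<open>card S\<close>.\<close>

lemma degree_vector_bounds:
  fixes p :: "'e::finite \<Rightarrow> 'a::finite" and q :: "'e \<Rightarrow> 'b::finite"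
  assumes T: "bip_tree p q T" and f: "\<And>a. card {e\<in>T. p e = a} = f a + 1"
  shows "(\<Sum>a\<in>UNIV. f a) + 1 = card (UNIV :: 'b set)"
    "S \<noteq> {} \<Longrightarrow> (\<Sum>a\<in>S. f a) + 1 \<le> card (q ` {e. p e \<in> S})"
proof -
  have sum: "card {e\<in>T. p e \<in> S} = (\<Sum>a\<in>S. f a) + card S" for S
    unfolding sum_card_fibres[symmetric] f sum.distrib by simp
  show "(\<Sum>a\<in>UNIV. f a) + 1 = card (UNIV :: 'b set)"
    using sum[of UNIV] card_bip_tree[OF T] by simp
  assume S: "S \<noteq> {}"
  then obtain s where s: "s \<in> S" by blast
  let ?T = "{e\<in>T. p e \<in> S}" and ?N = "q ` {e. p e \<in> S}"
  let ?V = "Inl ` S \<union> Inr ` ?N"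
  \<comment> \<open>The forest bound wants end maps with all values in \<open>?V\<close>; edges
    outside the forest are turned into loops at \<open>s\<close>.\<close>
  let ?t = "\<lambda>e. Inl (if e \<in> ?T then p e else s)"
  let ?h = "\<lambda>e. if e \<in> ?T then Inr (q e) else Inl s"
  have br: "all_bridges (\<lambda>e. Inl (p e)) (\<lambda>e. Inr (q e)) ?T"
    using T by (intro all_bridges_subset[of _ _ T ?T]) (auto simp: cut_tree_def)
  have "all_bridges ?t ?h ?T"
    using br unfolding all_bridges_def closed_under_def by simp
  then have "card ?T + 1 \<le> card ?V"
    using s by (intro all_bridges_card_le[of ?V ?t ?h]) auto
  also have "card ?V = card S + card ?N"
    by (subst card_Un_disjoint) (auto simp: card_image)
  finally show "(\<Sum>a\<in>S. f a) + 1 \<le> card ?N" using sum[of S] by simp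
qed

text \<open>Hall's theorem assigns all right vertices but one as children to left vertices, \<open>f a\<close> of them to
  \<open>a\<close>.  Growing a tree from the remaining vertex, the inequality for the unreached left vertices
  provides an edge that reaches a new one.\<close>
lemma degree_vector_exists:
  fixes p :: "'e::finite \<Rightarrow> 'a::finite" and q :: "'e \<Rightarrow> 'b::finite"
  assumes total: "(\<Sum>a\<in>UNIV. f a) + 1 = card (UNIV :: 'b set)"
    and le: "\<And>S. S \<noteq> {} \<Longrightarrow> (\<Sum>a\<in>S. f a) + 1 \<le> card (q ` {e. p e \<in> S})"
  shows "\<exists>T. bip_tree p q T \<and> (\<forall>a. card {e\<in>T. p e = a} = f a + 1)"
proof -
  define r :: 'b where "r = undefined"
  \<comment> \<open>\<open>f a\<close> copies of each left vertex \<open>a\<close>, to be matched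
    with distinct neighbors other than the root \<open>r\<close>.\<close>
  define I where "I = (SIGMA a:UNIV. {..<f a})"
  define N where "N i = q ` {e. p e = fst i} - {r}" for i :: "'a \<times> nat"
  have "\<exists>g. inj_on g I \<and> (\<forall>i\<in>I. g i \<in> N i)"
  proof (rule hall_marriage)
    show "finite I" unfolding I_def by auto
    fix J assume J: "J \<subseteq> I"
    show "card J \<le> card (\<Union>i\<in>J. N i)"
    proof (cases "J = {}")
      case False
      have "J \<subseteq> (SIGMA a:fst ` J. {..<f a})" using J unfolding I_def by force
      then have "card J \<le> card (SIGMA a:fst ` J. {..<f a})" by (intro card_mono) auto
      also have "\<dots> = (\<Sum>a\<in>fst ` J. f a)" by simp
      \<comment> \<open>The \<open>+ 1\<close> in the hypothesis pays for the removal of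
        \<open>r\<close> from the neighbors.\<close>
      also have "\<dots> \<le> card (q ` {e. p e \<in> fst ` J}) - 1"
        using le[of "fst ` J"] False by auto
      also have "\<dots> \<le> card (q ` {e. p e \<in> fst ` J} - {r})" by (simp add: card_Diff_singleton_if)
      also have "q ` {e. p e \<in> fst ` J} - {r} = (\<Union>i\<in>J. N i)" unfolding N_def by auto
      finally show ?thesis .
    qed simp
  qed (simp add: N_def)
  then obtain g where g: "inj_on g I" "\<And>i. i \<in> I \<Longrightarrow> g i \<in> N i" by blast
  have cardI: "card I = card (UNIV :: 'b set) - 1" using total unfolding I_def by simp
  have gI: "g ` I = UNIV - {r}"
    using g(2) unfolding N_def
    by (intro card_subset_eq) (auto simp: card_image[OF g(1)] cardI)
  define \<phi> where "\<phi> b = fst (inv_into I g b)" for b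
  have "\<exists>e. p e = \<phi> b \<and> q e = b" if "b \<noteq> r" for b
  proof -
    have "b \<in> g ` I" using that gI by simp
    then have "inv_into I g b \<in> I" "g (inv_into I g b) = b" by (auto simp: inv_into_into f_inv_into_f)
    then show ?thesis using g(2)[of "inv_into I g b"] unfolding \<phi>_def N_def by auto
  qed
  then obtain \<epsilon> where \<epsilon>: "\<And>b. b \<noteq> r \<Longrightarrow> p (\<epsilon> b) = \<phi> b \<and> q (\<epsilon> b) = b" by metis
  have card_fibre: "card {b. b \<noteq> r \<and> \<phi> b \<in> S} = (\<Sum>a\<in>S. f a)" for S
  proof -
    have "{b. b \<noteq> r \<and> \<phi> b \<in> S} = g ` (SIGMA a:S. {..<f a})"
    proof (intro equalityI subsetI)
      fix b assume b: "b \<in> {b. b \<noteq> r \<and> \<phi> b \<in> S}"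
      then have "b \<in> g ` I" using gI by simp
      then have "inv_into I g b \<in> I" "g (inv_into I g b) = b" by (auto simp: inv_into_into f_inv_into_f)
      moreover have "inv_into I g b \<in> (SIGMA a:S. {..<f a})"
        using b calculation(1) unfolding \<phi>_def I_def by auto
      ultimately show "b \<in> g ` (SIGMA a:S. {..<f a})" by (metis imageI)
    next
      fix b assume "b \<in> g ` (SIGMA a:S. {..<f a})"
      then obtain i where i: "i \<in> (SIGMA a:S. {..<f a})" "b = g i" by blast
      then have "i \<in> I" unfolding I_def by auto
      then show "b \<in> {b. b \<noteq> r \<and> \<phi> b \<in> S}"
        using i g gI unfolding \<phi>_def by (auto simp: inv_into_f_f)
    qed
    moreover have "inj_on g (SIGMA a:S. {..<f a})"
      by (rule inj_on_subset[OF g(1)]) (auto simp: I_def)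
    ultimately show ?thesis by (simp add: card_image)
  qed
  \<comment> \<open>The part of the tree grown so far: \<open>\<phi> b\<close> is the parent of
    \<open>b\<close>, \<open>\<epsilon> b\<close> the edge to it, and \<open>\<pi> a\<close> the
    edge through which \<open>a\<close> was reached from the older part.\<close>
  define V where "V X = Inl ` X \<union> Inr ` ({r} \<union> {b. b \<noteq> r \<and> \<phi> b \<in> X})" for X
  define T where "T \<pi> X = \<pi> ` X \<union> \<epsilon> ` {b. b \<noteq> r \<and> \<phi> b \<in> X}" for \<pi> X
  let ?t = "\<lambda>e. Inl (p e) :: 'a + 'b" and ?h = "\<lambda>e. Inr (q e) :: 'a + 'b"
  define ok where "ok X \<longleftrightarrow> (\<exists>\<pi>. (\<forall>a. a \<in> X \<longrightarrow> p (\<pi> a) = a) \<and>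
    ?h ` T \<pi> X \<subseteq> V X \<and> spans (V X) ?t ?h (T \<pi> X))" for X
  have "spans (V {}) ?t ?h (T \<pi> {})" "?h ` T \<pi> {} \<subseteq> V {}" for \<pi>
    unfolding spans_def V_def T_def by auto
  then have "ok {}" unfolding ok_def by blast
  then obtain X where X: "ok X" "\<And>Y. ok Y \<Longrightarrow> card Y \<le> card X"
    using ex_has_greatest_nat[of ok "{}" card "Suc (card (UNIV :: 'a set))"]
    by (auto simp: card_mono less_Suc_eq_le)
  obtain \<pi> where \<pi>: "\<And>a. a \<in> X \<Longrightarrow> p (\<pi> a) = a" "spans (V X) ?t ?h (T \<pi> X)"
    and inV: "?h ` T \<pi> X \<subseteq> V X"
    using X(1) unfolding ok_def by blast
  have "X = UNIV"
  proof (rule ccontr)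
    assume "X \<noteq> UNIV"
    then have ne: "- X \<noteq> {}" by auto
    have "\<not> q ` {e. p e \<in> - X} \<subseteq> {b. b \<noteq> r \<and> \<phi> b \<in> - X}"
    proof
      assume "q ` {e. p e \<in> - X} \<subseteq> {b. b \<noteq> r \<and> \<phi> b \<in> - X}"
      then have "card (q ` {e. p e \<in> - X}) \<le> (\<Sum>a\<in>- X. f a)"
        unfolding card_fibre[symmetric] by (intro card_mono) auto
      then show False using le[OF ne] by simp
    qed
    then obtain e where e: "p e \<notin> X" "q e = r \<or> \<phi> (q e) \<in> X" by auto
    let ?X = "insert (p e) X" and ?\<pi> = "\<pi>(p e := e)"
    have T_mono: "T \<pi> X \<subseteq> T ?\<pi> ?X" using e(1) unfolding T_def by auto
    have "spans (V ?X) ?t ?h (T ?\<pi> ?X)"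
      unfolding spans_def
    proof (intro allI impI)
      fix Z assume Z: "Z \<subseteq> V ?X" "closed_under ?t ?h (T ?\<pi> ?X) Z"
      have "closed_under ?t ?h (T \<pi> X) (Z \<inter> V X)"
        unfolding closed_under_def
      proof
        fix x assume x: "x \<in> T \<pi> X"
        then have "?t x \<in> Z \<longleftrightarrow> ?h x \<in> Z" using Z(2) T_mono unfolding closed_under_def by blast
        moreover have "?h x \<in> V X" using x inV by blast
        moreover have "?t x \<in> V X"
          using x \<pi>(1) \<epsilon> unfolding T_def V_def by auto
        ultimately show "?t x \<in> Z \<inter> V X \<longleftrightarrow> ?h x \<in> Z \<inter> V X" by blast
      qed
      then have "Z \<inter> V X = {} \<or> Z \<inter> V X = V X" using \<pi>(2) unfolding spans_def by blast
      moreover have "Inl (p e) \<in> Z \<longleftrightarrow> Inr (q e) \<in> Z"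
        using Z(2) unfolding closed_under_def T_def by auto
      moreover have "Inl (p e) \<in> Z \<longleftrightarrow> Inr b \<in> Z" if "b \<noteq> r" "\<phi> b = p e" for b
      proof -
        have "\<epsilon> b \<in> T ?\<pi> ?X" using that unfolding T_def by auto
        then show ?thesis using Z(2) \<epsilon>[OF that(1)] that(2) unfolding closed_under_def by auto
      qed
      moreover have "Inr (q e) \<in> V X" using e(2) unfolding V_def by auto
      moreover have "V ?X = V X \<union> {Inl (p e)} \<union> Inr ` {b. b \<noteq> r \<and> \<phi> b = p e}"
        unfolding V_def by auto
      ultimately show "Z = {} \<or> Z = V ?X" using Z(1) by blast
    qed
    moreover have "?h ` T ?\<pi> ?X \<subseteq> V ?X"
    proof -
      have "insert (?h e) (?h ` \<pi> ` X) \<subseteq> V X"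
      proof (rule insert_subsetI)
        show "?h e \<in> V X" using e(2) unfolding V_def by auto
        show "?h ` \<pi> ` X \<subseteq> V X" using inV unfolding T_def by blast
      qed
      also have "V X \<subseteq> V ?X" unfolding V_def by auto
      finally have "insert (?h e) (?h ` \<pi> ` X) \<subseteq> V ?X" .
      moreover have "?h ` ?\<pi> ` ?X \<subseteq> insert (?h e) (?h ` \<pi> ` X)" by auto
      ultimately have "?h ` ?\<pi> ` ?X \<subseteq> V ?X" by (rule order_trans[rotated])
      moreover have "?h ` \<epsilon> ` {b. b \<noteq> r \<and> \<phi> b \<in> ?X} \<subseteq> V ?X"
        using \<epsilon> unfolding V_def by auto
      ultimately show ?thesis unfolding T_def image_Un by (rule Un_least)
    qed
    moreover have "\<forall>a. a \<in> ?X \<longrightarrow> p (?\<pi> a) = a" using \<pi>(1) by auto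
    ultimately have "ok ?X" unfolding ok_def by blast
    then show False using X(2)[of ?X] e(1) by (simp add: card_insert_if)
  qed
  let ?T = "T \<pi> UNIV"
  have "x \<in> V UNIV" for x unfolding V_def by (cases x) auto
  then have "V UNIV = UNIV" by blast
  then have sp: "spans UNIV ?t ?h ?T" using \<pi>(2) \<open>X = UNIV\<close> by simp
  \<comment> \<open>Only an upper bound is immediate, as the chosen edges might coincide. The number
    of edges needed to span then forces equality at every vertex.\<close>
  have deg: "card {e\<in>?T. p e = a} \<le> f a + 1" for a
  proof -
    have "{e\<in>?T. p e = a} \<subseteq> insert (\<pi> a) (\<epsilon> ` {b. b \<noteq> r \<and> \<phi> b \<in> {a}})"
      using \<pi>(1) \<open>X = UNIV\<close> \<epsilon> unfolding T_def by auto
    then have "card {e\<in>?T. p e = a} \<le> card (insert (\<pi> a) (\<epsilon> ` {b. b \<noteq> r \<and> \<phi> b \<in> {a}}))"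
      by (intro card_mono) auto
    also have "\<dots> \<le> Suc (card (\<epsilon> ` {b. b \<noteq> r \<and> \<phi> b \<in> {a}}))" by (simp add: card_insert_if)
    also have "\<dots> \<le> Suc (f a)" using card_image_le[of "{b. b \<noteq> r \<and> \<phi> b \<in> {a}}" \<epsilon>] card_fibre[of "{a}"] by simp
    finally show ?thesis by simp
  qed
  have sumT: "(\<Sum>a\<in>UNIV. card {e\<in>?T. p e = a}) = card ?T"
    using sum_card_fibres[of ?T p UNIV] by simp
  have sumf: "(\<Sum>a\<in>UNIV. f a + 1) + 1 = card (UNIV :: 'a set) + card (UNIV :: 'b set)"
    unfolding sum.distrib using total by simp
  have "card ?T \<le> (\<Sum>a\<in>UNIV. f a + 1)" unfolding sumT[symmetric] by (intro sum_mono deg)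
  moreover have "card (UNIV :: ('a + 'b) set) \<le> card ?T + 1"
    by (rule spans_card_ge[OF _ _ _ _ _ sp]) auto
  ultimately have cT: "card ?T = (\<Sum>a\<in>UNIV. f a + 1)" using sumf by (simp add: card_UNIV_sum)
  have "bip_tree p q ?T"
    using sp cT sumf by (subst cut_tree_iff_spans_card) (auto simp: card_UNIV_sum)
  moreover have "card {e\<in>?T. p e = a} = f a + 1" for a
    by (rule sum_mono_inv[of _ UNIV]) (use deg cT sumT in auto)
  ultimately show ?thesis by blast
qed

text \<open>The hull lies in the convex set \<open>C\<close> cut out by the linear conditions, and
  the integer points of \<open>C\<close> meet the hypotheses of \<open>degree_vector_exists\<close>;
  so taking the hull adds no integer point.\<close>

lemma card_integer_points_degree_vectors:
  fixes p :: "'e::finite \<Rightarrow> 'a::finite" and q :: "'e \<Rightarrow> 'b::finite"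
  defines "H \<equiv> {f. \<exists>T. bip_tree p q T \<and> (\<forall>a. card {e\<in>T. p e = a} = f a + 1)}"
  shows "card ((convex hull {(\<chi> x. real (f x)) | f. f \<in> H}) \<inter> integer_points) = card H"
proof -
  let ?v = "\<lambda>f. (\<chi> x. real (f x)) :: real ^ 'a"
  let ?P = "convex hull {?v f | f. f \<in> H}"
  define n :: "'a set \<Rightarrow> real" where "n S = real (card (q ` {e. p e \<in> S}))" for S
  \<comment> \<open>Nonnegativity makes every integer point of \<open>C\<close> a vector of natural
    numbers.\<close>
  define C where "C = {z :: real ^ 'a. (\<forall>a. 0 \<le> z $ a) \<and> (\<Sum>a\<in>UNIV. z $ a) + 1 = real (card (UNIV :: 'b set))
    \<and> (\<forall>S. S \<noteq> {} \<longrightarrow> (\<Sum>a\<in>S. z $ a) + 1 \<le> n S)}"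
  have HC: "?v f \<in> C \<longleftrightarrow> f \<in> H" for f
  proof
    assume "f \<in> H"
    then obtain T where T: "bip_tree p q T" "\<And>a. card {e\<in>T. p e = a} = f a + 1" unfolding H_def by blast
    have "real ((\<Sum>a\<in>UNIV. f a) + 1) = real (card (UNIV :: 'b set))"
      using degree_vector_bounds(1)[OF T] by simp
    moreover have "real ((\<Sum>a\<in>S. f a) + 1) \<le> n S" if "S \<noteq> {}" for S
      unfolding n_def of_nat_le_iff by (rule degree_vector_bounds(2)[OF T that])
    ultimately show "?v f \<in> C" unfolding C_def by (simp add: add.commute)
  next
    assume f: "?v f \<in> C"
    then have "real ((\<Sum>a\<in>UNIV. f a) + 1) = real (card (UNIV :: 'b set))"
      unfolding C_def by simp
    then have 1: "(\<Sum>a\<in>UNIV. f a) + 1 = card (UNIV :: 'b set)" by (simp only: of_nat_eq_iff)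
    have 2: "(\<Sum>a\<in>S. f a) + 1 \<le> card (q ` {e. p e \<in> S})" if "S \<noteq> {}" for S
    proof -
      have "real ((\<Sum>a\<in>S. f a) + 1) \<le> n S" using f that unfolding C_def by (simp add: add.commute)
      then show ?thesis unfolding n_def by (simp only: of_nat_le_iff)
    qed
    show "f \<in> H" unfolding H_def using degree_vector_exists[OF 1 2] by blast
  qed
  have "convex C"
  proof (rule convexI)
    fix x y :: "real ^ 'a" and u v :: real
    assume x: "x \<in> C" and y: "y \<in> C" and uv: "0 \<le> u" "0 \<le> v" "u + v = 1"
    have sum: "(\<Sum>a\<in>S. (u *\<^sub>R x + v *\<^sub>R y) $ a) + 1 = u * ((\<Sum>a\<in>S. x $ a) + 1) + v * ((\<Sum>a\<in>S. y $ a) + 1)" for S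
      using uv(3) by (simp add: sum.distrib sum_distrib_left[symmetric] distrib_left)
    have one: "u * k + v * k = k" for k using uv(3) by (metis distrib_right mult_1)
    show "u *\<^sub>R x + v *\<^sub>R y \<in> C"
      unfolding C_def mem_Collect_eq
    proof (intro conjI allI impI)
      show "0 \<le> (u *\<^sub>R x + v *\<^sub>R y) $ a" for a using x y uv unfolding C_def by simp
      show "(\<Sum>a\<in>UNIV. (u *\<^sub>R x + v *\<^sub>R y) $ a) + 1 = real (card (UNIV :: 'b set))"
        unfolding sum using x y one unfolding C_def by simp
      fix S :: "'a set" assume "S \<noteq> {}"
      then have "u * ((\<Sum>a\<in>S. x $ a) + 1) + v * ((\<Sum>a\<in>S. y $ a) + 1) \<le> u * n S + v * n S"
        using x y uv unfolding C_def by (intro add_mono mult_left_mono) auto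
      then show "(\<Sum>a\<in>S. (u *\<^sub>R x + v *\<^sub>R y) $ a) + 1 \<le> n S" unfolding sum one .
    qed
  qed
  then have PC: "?P \<subseteq> C" using HC by (intro hull_minimal) auto
  have "?P \<inter> integer_points = ?v ` H"
  proof (intro equalityI subsetI)
    fix z assume z: "z \<in> ?P \<inter> integer_points"
    define f where "f x = nat \<lfloor>z $ x\<rfloor>" for x
    have "real (f x) = z $ x" for x
      using z PC unfolding f_def C_def integer_points_def by (auto simp: of_nat_nat elim!: Ints_cases)
    then have "z = ?v f" by (simp add: vec_eq_iff)
    moreover have "z \<in> C" using z PC by blast
    ultimately show "z \<in> ?v ` H" using HC by blast
  next
    fix z assume "z \<in> ?v ` H"
    then obtain f where f: "f \<in> H" "z = ?v f" by blast
    then have "z \<in> ?P" by (intro hull_inc) blast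
    then show "z \<in> ?P \<inter> integer_points" using f(2) unfolding integer_points_def by simp
  qed
  moreover have "inj_on ?v H" by (rule inj_onI) (auto simp: vec_eq_iff)
  ultimately show ?thesis by (simp add: card_image)
qed

section \<open>Drawings on the sphere\<close>

text \<open>A subdrawing grows by edges that touch it. An edge with a new endpoint adds a vertex and
  no region, an edge between old vertices adds at most one region, and both keep the bound.
  Path-connectedness is carried along because \<open>components_add_arc\<close> requires it.\<close>

lemma plane_euler:
  fixes P :: "'v::finite \<Rightarrow> complex" and g :: "'e::finite \<Rightarrow> real \<Rightarrow> complex"
  assumes P: "inj P" and g: "\<And>e. arc (g e)" "\<And>e. pathstart (g e) = P (t e)" "\<And>e. pathfinish (g e) = P (h e)"
    and gP: "\<And>e. path_image (g e) \<inter> range P = {P (t e), P (h e)}"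
    and gg: "\<And>e e'. e \<noteq> e' \<Longrightarrow> path_image (g e) \<inter> path_image (g e') \<subseteq> range P"
    and sp: "spans UNIV t h UNIV"
  shows "finite (components (- (range P \<union> (\<Union>e. path_image (g e)))))"
    "card (components (- (range P \<union> (\<Union>e. path_image (g e))))) + card (UNIV :: 'v set) \<le> card (UNIV :: 'e set) + 2"
proof -
  define K where "K X S = P ` X \<union> (\<Union>e\<in>S. path_image (g e))" for X S
  define ok where "ok X S \<longleftrightarrow> X \<noteq> {} \<and> (\<forall>e\<in>S. t e \<in> X \<and> h e \<in> X) \<and> path_connected (K X S)
    \<and> finite (components (- K X S)) \<and> card (components (- K X S)) + card X \<le> card S + 2" for X S
  have compact: "compact (K X S)" for X S
    unfolding K_def
  proof (rule compact_Un)
    show "compact (P ` X)" by (rule finite_imp_compact) simp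
    show "compact (\<Union>e\<in>S. path_image (g e))" using g(1) by (intro compact_UN) (auto intro: compact_arc_image)
  qed
  \<comment> \<open>One vertex, no edge and one region: the bound reads
    \<open>1 + 1 \<le> 0 + 2\<close>.\<close>
  have "ok {undefined} {}"
  proof -
    have "topological_space_class.connected (- {P undefined})"
      by (rule connected_punctured_universe) simp
    then have "components (- {P undefined}) \<subseteq> {- {P undefined}}"
      using connected_eq_components_subset_sing by blast
    then have "finite (components (- {P undefined}))" "card (components (- {P undefined})) \<le> 1"
      using card_mono[of "{- {P undefined}}"] finite_subset by fastforce+
    then show ?thesis unfolding ok_def K_def by simp
  qed
  then have "\<exists>S. (\<exists>X. ok X S) \<and> (\<forall>S'. (\<exists>X. ok X S') \<longrightarrow> card S' \<le> card S)"
    using ex_has_greatest_nat[of "\<lambda>S. \<exists>X. ok X S" "{}" card "Suc (card (UNIV :: 'e set))"]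
    by (auto simp: card_mono less_Suc_eq_le)
  then obtain S X where X: "ok X S" and max: "\<And>S' X'. ok X' S' \<Longrightarrow> card S' \<le> card S" by blast
  have S: "S = UNIV"
  proof (rule ccontr)
    assume "S \<noteq> UNIV"
    have "\<exists>e. e \<notin> S \<and> (t e \<in> X \<or> h e \<in> X)"
    proof (cases "X = UNIV")
      case False
      then have "\<not> closed_under t h UNIV X" using sp X unfolding spans_def ok_def by blast
      then obtain e where "(t e \<in> X) \<noteq> (h e \<in> X)" unfolding closed_under_def by blast
      then show ?thesis using X unfolding ok_def by blast
    qed (use \<open>S \<noteq> UNIV\<close> in auto)
    then obtain e where e: "e \<notin> S" "t e \<in> X \<or> h e \<in> X" by blast
    let ?X = "X \<union> {t e, h e}" and ?S = "insert e S" and ?K = "K X S"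
    have "t e \<noteq> h e" using g(1)[of e] g(2)[of e] g(3)[of e] by (auto simp: arc_simple_path)
    have inX: "v \<in> X" if "P v \<in> path_image (g x)" "x \<in> S" for v x
    proof -
      have "P v \<in> {P (t x), P (h x)}" using gP[of x] that(1) by blast
      then have "v = t x \<or> v = h x" using P by (auto dest: injD)
      then show ?thesis using X that(2) unfolding ok_def by blast
    qed
    have K': "K ?X ?S = ?K \<union> path_image (g e)"
      using pathstart_in_path_image[of "g e"] pathfinish_in_path_image[of "g e"] g(2,3) unfolding K_def by auto
    have Kg: "?K \<inter> path_image (g e) = P ` (X \<inter> {t e, h e})"
    proof (intro equalityI subsetI)
      fix z assume z: "z \<in> ?K \<inter> path_image (g e)"
      have "z \<in> range P"
      proof (cases "z \<in> P ` X")
        case False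
        then obtain x where "x \<in> S" "z \<in> path_image (g x)" using z unfolding K_def by blast
        then show ?thesis using z gg[of e x] e(1) by blast
      qed auto
      then obtain v where v: "z = P v" by blast
      then have "P v \<in> {P (t e), P (h e)}" using z gP[of e] by blast
      then have "v \<in> {t e, h e}" using P by (auto dest: injD)
      moreover have "v \<in> X" using z v inX P unfolding K_def by (auto dest: injD)
      ultimately show "z \<in> P ` (X \<inter> {t e, h e})" using v by blast
    next
      fix z assume "z \<in> P ` (X \<inter> {t e, h e})"
      then show "z \<in> ?K \<inter> path_image (g e)" using gP[of e] unfolding K_def by blast
    qed
    have pc: "path_connected (?K \<union> path_image (g e))"
    proof (rule path_connected_Un)
      show "?K \<inter> path_image (g e) \<noteq> {}" using e(2) unfolding Kg by blast
      show "path_connected ?K" using X unfolding ok_def by blast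
      show "path_connected (path_image (g e))" by (rule path_connected_path_image[OF arc_imp_path[OF g(1)]])
    qed
    have fin: "finite (components (- ?K))" using X unfolding ok_def by blast
    have le: "card (components (- ?K)) + card X \<le> card S + 2" using X unfolding ok_def by blast
    have "finite (components (- K ?X ?S)) \<and> card (components (- K ?X ?S)) + card ?X \<le> card S + 3"
    proof (cases "{t e, h e} \<subseteq> X")
      case True
      then have "?K \<inter> path_image (g e) = {pathstart (g e), pathfinish (g e)}" unfolding Kg g by auto
      note add = components_add_arc[OF compact _ g(1) this fin]
      have "?X = X" using True by auto
      then show ?thesis unfolding K' using add X le unfolding ok_def by auto
    next
      case False
      then obtain u where u: "X \<inter> {t e, h e} = {u}" using e(2) by blast
      then have "?K \<inter> path_image (g e) = {P u}" unfolding Kg by simp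
      note add = components_add_pendant_arc[OF compact g(1) this fin]
      have "\<exists>v. v \<notin> X \<and> ?X = insert v X"
      proof (cases "t e \<in> X")
        case True
        then show ?thesis using \<open>\<not> {t e, h e} \<subseteq> X\<close> by (intro exI[of _ "h e"]) blast
      next
        case False
        then show ?thesis using e(2) by (intro exI[of _ "t e"]) blast
      qed
      then have "card ?X = Suc (card X)" by (metis card_insert_disjoint finite)
      then show ?thesis unfolding K' using add le by auto
    qed
    then have "ok ?X ?S" unfolding ok_def using X pc e(1) unfolding ok_def K' by auto
    then show False using max[of ?X ?S] e(1) by simp
  qed
  then have "closed_under t h UNIV X" using X unfolding ok_def closed_under_def by blast
  then have "X = UNIV" using sp X unfolding spans_def ok_def by blast
  then show "finite (components (- (range P \<union> (\<Union>e. path_image (g e)))))"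
    "card (components (- (range P \<union> (\<Union>e. path_image (g e))))) + card (UNIV :: 'v set) \<le> card (UNIV :: 'e set) + 2"
    using X S unfolding ok_def K_def by auto
qed

text \<open>Summation by parts: a cycle is orthogonal to every coboundary.\<close>

lemma sum_boundary_zero:
  fixes D :: "'v::finite \<Rightarrow> real"
  assumes "\<And>v. boundary t h c v = 0"
  shows "(\<Sum>e\<in>UNIV. c e * (D (h e) - D (t e))) = 0"
proof -
  have D: "(\<Sum>v\<in>UNIV. D v * of_bool (x = v)) = D x" for x
  proof -
    have "(\<Sum>v\<in>UNIV. D v * of_bool (x = v)) = (\<Sum>v\<in>UNIV. if v = x then D v else 0)"
      by (intro sum.cong) auto
    then show ?thesis by simp
  qed
  have "c e * (D (h e) - D (t e)) = (\<Sum>v\<in>UNIV. D v * (c e * (of_bool (h e = v) - of_bool (t e = v))))" for e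
    unfolding D[symmetric, of "h e"] D[symmetric, of "t e"] sum_subtractf[symmetric] sum_distrib_left
    by (intro sum.cong) (simp_all add: algebra_simps)
  then have "(\<Sum>e\<in>UNIV. c e * (D (h e) - D (t e)))
      = (\<Sum>e\<in>UNIV. \<Sum>v\<in>UNIV. D v * (c e * (of_bool (h e = v) - of_bool (t e = v))))"
    by simp
  also have "\<dots> = (\<Sum>v\<in>UNIV. D v * boundary t h c v)"
    unfolding boundary_def sum_distrib_left by (rule sum.swap)
  finally show ?thesis using assms by simp
qed

text \<open>By the exchange formula for disjoint paths, each arc contributes the difference of the winding
  numbers of \<open>d\<close> around its endpoints; these contributions cancel as \<open>c\<close> is a cycle.  For the arc that
  is crossed, \<open>d\<close> has to be replaced by the reverse of \<open>\<eta>\<close>, which costs the winding number \<open>1\<close>.\<close>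
lemma winding_potential:
  fixes P :: "'v::finite \<Rightarrow> complex" and g :: "'e::finite \<Rightarrow> real \<Rightarrow> complex"
  assumes g: "\<And>e. path (g e)" "\<And>e. pathstart (g e) = P (t e)" "\<And>e. pathfinish (g e) = P (h e)"
    and c: "\<And>v. boundary t h c v = 0"
    and d: "path d"
  defines "W z \<equiv> (\<Sum>e\<in>UNIV. c e * Re (winding_number (g e) z))"
  shows winding_potential_const:
      "(\<And>e. path_image (g e) \<inter> path_image d = {}) \<Longrightarrow> W (pathfinish d) = W (pathstart d)"
    and winding_potential_jump:
      "\<lbrakk>\<And>x. x \<noteq> e \<Longrightarrow> path_image (g x) \<inter> path_image d = {}; P (t e) \<notin> path_image d; P (h e) \<notin> path_image d;
        path \<eta>; path_image \<eta> \<inter> path_image (g e) = {}; pathstart \<eta> = pathfinish d; pathfinish \<eta> = pathstart d;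
        winding_number (d +++ \<eta>) (P (t e)) = 1; winding_number (d +++ \<eta>) (P (h e)) = 0\<rbrakk>
      \<Longrightarrow> W (pathfinish d) - W (pathstart d) = c e"
proof -
  \<comment> \<open>Neither \<open>d\<close> nor the arcs are closed, so their winding numbers may
    be complex. Taking real parts gives real potentials and respects the exchange formula.\<close>
  define D where "D v = Re (winding_number d (P v))" for v
  let ?\<Delta> = "\<lambda>e. Re (winding_number (g e) (pathfinish d)) - Re (winding_number (g e) (pathstart d))"
  have W: "W (pathfinish d) - W (pathstart d) = (\<Sum>e\<in>UNIV. c e * ?\<Delta> e)"
    unfolding W_def by (simp add: sum_subtractf[symmetric] right_diff_distrib)
  have \<Delta>: "?\<Delta> e = D (h e) - D (t e)" if "path_image (g e) \<inter> path_image d = {}" for e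
    using winding_number_disjoint_paths[OF g(1) d that] unfolding D_def g
    by (metis minus_complex.sel(1))
  {
    assume "\<And>e. path_image (g e) \<inter> path_image d = {}"
    then show "W (pathfinish d) = W (pathstart d)"
      using W \<Delta> sum_boundary_zero[of t h c D, OF c] by simp
  next
    assume away: "\<And>x. x \<noteq> e \<Longrightarrow> path_image (g x) \<inter> path_image d = {}"
      and de: "P (t e) \<notin> path_image d" "P (h e) \<notin> path_image d"
      and \<eta>: "path \<eta>" "path_image \<eta> \<inter> path_image (g e) = {}" "pathstart \<eta> = pathfinish d" "pathfinish \<eta> = pathstart d"
      and wn: "winding_number (d +++ \<eta>) (P (t e)) = 1" "winding_number (d +++ \<eta>) (P (h e)) = 0"
    have \<eta>e: "P (t e) \<notin> path_image \<eta>" "P (h e) \<notin> path_image \<eta>"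
      using \<eta>(2) pathstart_in_path_image[of "g e"] pathfinish_in_path_image[of "g e"] g(2,3) by auto
    have 1: "D (t e) + Re (winding_number \<eta> (P (t e))) = 1"
      using winding_number_join[OF d de(1) \<eta>(1) \<eta>e(1)] \<eta>(3) wn(1) unfolding D_def by (metis one_complex.sel(1) plus_complex.sel(1))
    have 2: "D (h e) + Re (winding_number \<eta> (P (h e))) = 0"
      using winding_number_join[OF d de(2) \<eta>(1) \<eta>e(2)] \<eta>(3) wn(2) unfolding D_def by (metis zero_complex.sel(1) plus_complex.sel(1))
    \<comment> \<open>\<open>\<eta>\<close> runs from the end of \<open>d\<close> back to its start,
      hence the minus sign.\<close>
    have "Re (winding_number \<eta> (P (h e))) - Re (winding_number \<eta> (P (t e))) = - ?\<Delta> e"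
      using winding_number_disjoint_paths[OF \<eta>(1) g(1) \<eta>(2)] unfolding g \<eta>(3,4)
      by (metis minus_complex.sel(1) minus_diff_eq)
    then have e: "?\<Delta> e = (D (h e) - D (t e)) + 1" using 1 2 by linarith
    have "?\<Delta> x = (D (h x) - D (t x)) + of_bool (x = e)" for x
      using e \<Delta>[OF away, of x] by (cases "x = e") auto
    then have "W (pathfinish d) - W (pathstart d)
        = (\<Sum>x\<in>UNIV. c x * (D (h x) - D (t x))) + (\<Sum>x\<in>UNIV. c x * of_bool (x = e))"
      unfolding W by (simp add: distrib_left sum.distrib)
    then show "W (pathfinish d) - W (pathstart d) = c e"
      using sum_boundary_zero[of t h c D, OF c] by (simp add: of_bool_def if_distrib cong: if_cong)
  }
qed

text \<open>Stereographic projection from a point of \<open>D\<close> reduces the claim to open subsets of the plane.\<close>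
lemma component_minus_point:
  fixes D :: "(real ^ 3) set"
  assumes D: "closed D" "D \<noteq> {}" "D \<subseteq> S2" and R: "R \<in> components (S2 - D)"
  shows "topological_space_class.connected (R - {p})" "R - {p} \<noteq> {}"
proof -
  obtain q where q: "q \<in> D" using D(2) by blast
  have "S2 - {q} homeomorphic (UNIV :: complex set)"
    using q D(3) by (intro homeomorphic_punctured_sphere_affine) auto
  then obtain f k where fk: "homeomorphism (S2 - {q}) (UNIV :: complex set) f k"
    unfolding homeomorphic_def by blast
  have RS: "R \<subseteq> S2 - D" by (rule in_components_subset[OF R])
  have conR: "topological_space_class.connected R" by (rule in_components_connected[OF R])
  have Rne: "R \<noteq> {}" by (rule in_components_nonempty[OF R])
  have Rq: "R \<subseteq> S2 - {q}" using RS q by blast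
  have opD: "openin (top_of_set S2) (S2 - D)"
    unfolding Diff_eq using D(1) by (intro openin_open_Int) auto
  have "locally topological_space_class.connected (S2 - D)"
    by (rule locally_open_subset[OF locally_connected_sphere opD])
  then have "openin (top_of_set (S2 - D)) R" by (rule openin_components_locally_connected[OF _ R])
  then have "openin (top_of_set S2) R" by (rule openin_trans[OF _ opD])
  then have "openin (top_of_set (S2 - {q})) R" by (rule openin_subset_trans[OF _ Rq]) blast
  then have "openin (top_of_set UNIV) (f ` R)" by (rule homeomorphism_imp_open_map[OF fk])
  then obtain U where "open U" "f ` R = UNIV \<inter> U" unfolding openin_open by blast
  then have op: "open (f ` R)" by simp
  have kf: "k (f x) = x" if "x \<in> S2 - {q}" for x using fk that by (simp add: homeomorphism_def)
  have contf: "continuous_on R f" and contk: "continuous_on UNIV k"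
    using fk continuous_on_subset[OF _ Rq, of f] unfolding homeomorphism_def by blast+
  have con: "topological_space_class.connected (f ` R)" by (rule connected_continuous_image[OF contf conR])
  have minus: "R - {p} = k ` (f ` R - {f p})" if "p \<in> R"
  proof -
    have "inj_on f (S2 - {q})" using kf by (rule inj_on_inverseI)
    then have "f ` (R - {p}) = f ` R - f ` {p}"
      by (rule inj_on_image_set_diff) (use Rq that in auto)
    moreover have "k ` f ` (R - {p}) = R - {p}"
    proof -
      have "k (f x) = x" if "x \<in> R - {p}" for x using kf[of x] Rq that by blast
      then show ?thesis by (simp add: image_image)
    qed
    ultimately show ?thesis by simp
  qed
  have "topological_space_class.connected (f ` R - {f p})"
    by (rule connected_open_delete[OF op con]) simp
  then have "topological_space_class.connected (k ` (f ` R - {f p}))"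
    by (rule connected_continuous_image[OF continuous_on_subset[OF contk subset_UNIV]])
  then show "topological_space_class.connected (R - {p})"
    using minus conR by (cases "p \<in> R") auto
  show "R - {p} \<noteq> {}"
  proof
    assume "R - {p} = {}"
    then have "R = {p}" using Rne by blast
    then show False using op not_open_singleton[of "f p"] by simp
  qed
qed

text \<open>The chart carries the drawing to the plane, where \<open>plane_euler\<close> and
  \<open>winding_potential\<close> apply, but it omits the point \<open>p\<close> of one region. By
  \<open>component_minus_point\<close> each region stays connected and non-empty without
  \<open>p\<close>, so regions can be counted, and values on them defined, by points other than
  \<open>p\<close>.\<close>

lemma sphere_embedding_bipartite_dual:
  fixes G :: "('a::finite, 'b::finite, 'e::finite) bigraph"
  assumes emb: "sphere_embedding G pos \<gamma>"
    and con: "Digraph_Component.connected (graph_of G)"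
    and dual: "directed_planar_dual pos \<gamma> D"
  shows "bipartite_dual (end0 G) (end1 G) (regions pos \<gamma>) (tail D) (head D)"
proof -
  let ?Dr = "drawing pos \<gamma>" and ?R = "regions pos \<gamma>"
  let ?t = "\<lambda>e. Inl (end0 G e) :: 'a + 'b" and ?h = "\<lambda>e. Inr (end1 G e) :: 'a + 'b"
  obtain p h k where p: "p \<in> S2 - ?Dr" and hom: "homeomorphism (S2 - {p}) (UNIV :: complex set) h k"
    and cross: "\<forall>e. crosses_positively h p (\<gamma> e) (tail D e) (head D e)"
    using dual unfolding directed_planar_dual_def by (elim conjE exE) (rule that)
  have tails: "tail D e \<in> ?R" "head D e \<in> ?R" for e
    using dual unfolding directed_planar_dual_def by auto
  have conth: "continuous_on (S2 - {p}) h" and contk: "continuous_on UNIV k"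
    and kS: "\<And>z. k z \<in> S2 - {p}" and hk: "\<And>z. h (k z) = z"
    using hom unfolding homeomorphism_def by blast+
  have kh: "k (h x) = x" if "x \<in> S2 - {p}" for x
    using hom that unfolding homeomorphism_def by blast
  have inj_h: "inj_on h (S2 - {p})" using kh by (rule inj_on_inverseI)
  have inj_pos: "inj pos" and Dr_S2: "?Dr \<subseteq> S2"
    and arc\<gamma>: "\<And>e. arc (\<gamma> e)" and start: "\<And>e. pathstart (\<gamma> e) = pos (?t e)"
    and fin: "\<And>e. pathfinish (\<gamma> e) = pos (?h e)"
    and int_pos: "\<And>e. \<gamma> e ` {0<..<1} \<inter> range pos = {}"
    and int_int: "\<And>e e'. e \<noteq> e' \<Longrightarrow> \<gamma> e ` {0<..<1} \<inter> \<gamma> e' ` {0<..<1} = {}"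
    using emb unfolding sphere_embedding_def by simp_all
  have Dr: "?Dr \<subseteq> S2 - {p}" using Dr_S2 p by blast
  have pos_Dr: "range pos \<subseteq> ?Dr" and \<gamma>_Dr: "\<And>e. path_image (\<gamma> e) \<subseteq> ?Dr"
    unfolding drawing_def by auto
  have img: "path_image (\<gamma> e) = {pos (?t e), pos (?h e)} \<union> \<gamma> e ` {0<..<1}" for e
  proof -
    have "{0..1::real} = {0, 1} \<union> {0<..<1}" by auto
    then have "path_image (\<gamma> e) = {\<gamma> e 0, \<gamma> e 1} \<union> \<gamma> e ` {0<..<1}"
      unfolding path_image_def by (simp only: image_Un image_insert image_empty)
    then show ?thesis using start[of e] fin[of e] unfolding pathstart_def pathfinish_def by simp
  qed
  have "compact ?Dr"
    unfolding drawing_def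
  proof (rule compact_Un)
    show "compact (range pos)" by (rule finite_imp_compact) simp
    show "compact (\<Union>e. path_image (\<gamma> e))" using arc\<gamma> by (intro compact_UN) (auto intro: compact_arc_image)
  qed
  then have closedDr: "closed ?Dr" by (rule compact_imp_closed)
  have neDr: "?Dr \<noteq> {}" using pos_Dr by auto
  note region = component_minus_point[OF closedDr neDr Dr_S2, folded regions_def, of _ p]

  define P where "P v = h (pos v)" for v
  define g where "g e = h \<circ> \<gamma> e" for e
  define K where "K = h ` ?Dr"
  have hInt: "h ` A \<inter> h ` B = h ` (A \<inter> B)" if "A \<subseteq> S2 - {p}" "B \<subseteq> S2 - {p}" for A B
    using inj_on_image_Int[OF inj_h that] by simp
  have g_img: "path_image (g e) = h ` path_image (\<gamma> e)" for e
    unfolding g_def by (rule path_image_compose)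
  have rangeP: "range P = h ` range pos" unfolding P_def by auto
  have K: "K = range P \<union> (\<Union>e. path_image (g e))"
    unfolding K_def drawing_def rangeP g_img by blast
  have g_path: "path (g e)" for e
    unfolding g_def
    by (rule path_continuous_image[OF arc_imp_path[OF arc\<gamma>] continuous_on_subset[OF conth]])
      (rule order_trans[OF \<gamma>_Dr Dr])
  have g_arc: "arc (g e)" for e
  proof -
    have "inj_on (h \<circ> \<gamma> e) {0..1}"
      using arc\<gamma>[of e] \<gamma>_Dr[of e] Dr unfolding arc_def path_image_def
      by (intro comp_inj_on inj_on_subset[OF inj_h]) auto
    then show ?thesis using g_path[of e] unfolding arc_def g_def by simp
  qed
  have g_ends: "pathstart (g e) = P (?t e)" "pathfinish (g e) = P (?h e)" for e
    using start[of e] fin[of e] unfolding g_def P_def pathstart_def pathfinish_def by simp_all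
  have injP: "inj P"
    using inj_pos pos_Dr Dr inj_h unfolding P_def inj_def by (metis (no_types, lifting) inj_onD rangeI subsetD)
  have gP: "path_image (g e) \<inter> range P = {P (?t e), P (?h e)}" for e
  proof -
    have "path_image (g e) \<inter> range P = h ` (path_image (\<gamma> e) \<inter> range pos)"
      unfolding g_img rangeP by (rule hInt) (use \<gamma>_Dr pos_Dr Dr in blast)+
    also have "path_image (\<gamma> e) \<inter> range pos = {pos (?t e), pos (?h e)}"
      unfolding img using int_pos[of e] by blast
    finally show ?thesis unfolding P_def by simp
  qed
  have gg: "path_image (g e) \<inter> path_image (g e') \<subseteq> range P" if "e \<noteq> e'" for e e'
  proof -
    have "path_image (g e) \<inter> path_image (g e') = h ` (path_image (\<gamma> e) \<inter> path_image (\<gamma> e'))"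
      unfolding g_img by (rule hInt) (use \<gamma>_Dr Dr in blast)+
    also have "path_image (\<gamma> e) \<inter> path_image (\<gamma> e') \<subseteq> range pos"
      unfolding img using int_int[OF that] int_pos[of e] int_pos[of e'] by blast
    finally show ?thesis unfolding rangeP by blast
  qed
  have sp: "spans UNIV ?t ?h UNIV"
  proof -
    have "(graph_of G)\<lparr>arcs := UNIV\<rparr> = graph_of G" by (simp add: graph_of_def)
    then show ?thesis
      using con connected_iff_spans[of "graph_of G" UNIV] by (simp add: graph_of_def)
  qed
  have euler: "finite (components (- K))"
    "card (components (- K)) + card (UNIV :: ('a + 'b) set) \<le> card (UNIV :: 'e set) + 2"
    unfolding K by (rule plane_euler[OF injP g_arc g_ends gP _ sp]; rule gg; assumption)+

  have h_notin_K: "h x \<notin> K" if "x \<in> S2 - {p} - ?Dr" for x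
  proof
    assume "h x \<in> K"
    then obtain y where "y \<in> ?Dr" "h x = h y" unfolding K_def by blast
    then show False using that inj_onD[OF inj_h, of x y] Dr by blast
  qed
  have k_notin_Dr: "k z \<in> S2 - ?Dr" if "z \<notin> K" for z
    using that kS[of z] hk[of z] unfolding K_def by (metis DiffD1 DiffI imageI)
  have "finite (components (S2 - ?Dr)) \<and> card (components (S2 - ?Dr)) \<le> card (components (- K))"
  proof -
    let ?C = "connected_component_set (S2 - ?Dr)"
    \<comment> \<open>A representative of the region of \<open>x\<close> other than
      \<open>p\<close>, where the chart is available even if \<open>x = p\<close>.\<close>
    define y where "y x = (SOME y. y \<in> ?C x - {p})" for x
    have y: "y x \<in> ?C x - {p}" if "x \<in> S2 - ?Dr" for x
    proof -
      have "?C x \<in> ?R" unfolding regions_def using that by (rule componentsI)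
      then have "?C x - {p} \<noteq> {}" by (rule region(2))
      then have "\<exists>y. y \<in> ?C x - {p}" by (simp only: ex_in_conv not_False_eq_True)
      then show ?thesis unfolding y_def by (rule someI_ex)
    qed
    have yS: "y x \<in> S2 - {p} - ?Dr" if "x \<in> S2 - ?Dr" for x
    proof -
      have "y x \<in> S2 - ?Dr" by (rule subsetD[OF connected_component_subset DiffD1[OF y[OF that]]])
      moreover have "y x \<notin> {p}" using y[OF that] by (meson DiffD2)
      ultimately show ?thesis by blast
    qed
    let ?\<phi> = "\<lambda>x. connected_component_set (- K) (h (y x))"
    have 1: "?\<phi> x \<in> components (- K)" if "x \<in> S2 - ?Dr" for x
      using h_notin_K[OF yS[OF that]] by (intro componentsI) (simp only: Compl_iff not_False_eq_True)
    have 2: "connected_component (S2 - ?Dr) x x'"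
      if x: "x \<in> S2 - ?Dr" and x': "x' \<in> S2 - ?Dr" and eq: "?\<phi> x = ?\<phi> x'" for x x'
    proof -
      have "h (y x') \<in> ?\<phi> x" unfolding eq using h_notin_K[OF yS[OF x']] by simp
      then obtain T where T: "topological_space_class.connected T" "T \<subseteq> - K" "h (y x) \<in> T" "h (y x') \<in> T"
        unfolding connected_component_def by blast
      have 3: "connected_component (S2 - ?Dr) (y x) (y x')"
      proof (rule connected_componentI)
        show "topological_space_class.connected (k ` T)"
          by (rule connected_continuous_image[OF continuous_on_subset[OF contk subset_UNIV] T(1)])
        show "k ` T \<subseteq> S2 - ?Dr" using T(2) k_notin_Dr by blast
        show "y x \<in> k ` T" using T(3) kh[of "y x"] yS[OF x] by (metis DiffD1 imageI)
        show "y x' \<in> k ` T" using T(4) kh[of "y x'"] yS[OF x'] by (metis DiffD1 imageI)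
      qed
      have 4: "connected_component (S2 - ?Dr) x (y x)"
        by (rule DiffD1[OF y[OF x], unfolded mem_Collect_eq])
      have 5: "connected_component (S2 - ?Dr) (y x') x'"
        by (rule connected_component_sym[OF DiffD1[OF y[OF x'], unfolded mem_Collect_eq]])
      show ?thesis by (rule connected_component_trans[OF connected_component_trans[OF 4 3] 5])
    qed
    show ?thesis
      by (rule conjI[OF card_components_le(1)[OF euler(1) 1 2] card_components_le(2)[OF euler(1) 1 2]])
  qed
  then have R: "finite ?R" "card ?R \<le> card (components (- K))" unfolding regions_def by auto

  have openK: "open (- K)"
  proof -
    have "compact K" unfolding K_def
      using \<open>compact ?Dr\<close> Dr by (intro compact_continuous_image continuous_on_subset[OF conth])
    then show ?thesis by (simp add: compact_imp_closed open_Compl)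
  qed
  show ?thesis
  proof
    show "spans UNIV ?t ?h UNIV" by (rule sp)
    show "finite ?R" by (rule R(1))
    show "?R \<noteq> {}" using tails by blast
    show "range (tail D) \<subseteq> ?R" "range (head D) \<subseteq> ?R" using tails by auto
    show "card ?R + card (UNIV :: ('a + 'b) set) \<le> card (UNIV :: 'e set) + 2" using R(2) euler(2) by linarith
    fix c :: "'e \<Rightarrow> real"
    assume c: "\<And>v. boundary ?t ?h c v = 0"
    define W where "W z = (\<Sum>e\<in>UNIV. c e * Re (winding_number (g e) z))" for z
    \<comment> \<open>By \<open>W_const\<close> the choice of the point in the region does not
      matter.\<close>
    define w where "w R = W (h (SOME y. y \<in> R - {p}))" for R
    have W_const: "W (h x) = W (h y)" if r: "r \<in> ?R" and x: "x \<in> r - {p}" and y: "y \<in> r - {p}" for r x y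
    proof -
      have rS: "r \<subseteq> S2 - ?Dr" using r in_components_subset unfolding regions_def by blast
      have "connected_component (- K) (h x) (h y)"
      proof (rule connected_componentI)
        show "topological_space_class.connected (h ` (r - {p}))"
          using rS by (intro connected_continuous_image continuous_on_subset[OF conth] region(1)[OF r]) auto
        show "h ` (r - {p}) \<subseteq> - K" using h_notin_K rS by blast
      qed (use x y in auto)
      then have "path_component (- K) (h x) (h y)" using open_path_connected_component[OF openK] by metis
      then obtain d where d: "path d" "path_image d \<subseteq> - K" "pathstart d = h x" "pathfinish d = h y"
        unfolding path_component_def by blast
      have "path_image (g e) \<inter> path_image d = {}" for e using d(2) K by blast
      then have "W (pathfinish d) = W (pathstart d)"
        unfolding W_def by (intro winding_potential_const[OF g_path g_ends c d(1)])
      then show ?thesis unfolding d(3,4) by simp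
    qed
    have Ww: "W (h x) = w r" if "r \<in> ?R" "x \<in> r - {p}" for r x
    proof -
      have "(SOME y. y \<in> r - {p}) \<in> r - {p}" using that(2) by (rule someI)
      then show ?thesis unfolding w_def by (rule W_const[OF that])
    qed
    have "w (head D e) - w (tail D e) = c e" for e
    proof -
      obtain \<delta> \<eta> t where \<delta>: "path \<delta>" "path_image \<delta> \<subseteq> S2 - {p}" and t: "0 < t" "t < 1"
        and \<delta>t: "\<delta> ` {0..<t} \<subseteq> tail D e" "\<delta> t \<in> \<gamma> e ` {0<..<1}" "\<delta> ` {t<..1} \<subseteq> head D e"
        and \<eta>: "path \<eta>" "path_image \<eta> \<subseteq> S2 - {p} - path_image (\<gamma> e)"
          "pathstart \<eta> = pathfinish \<delta>" "pathfinish \<eta> = pathstart \<delta>"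
        and wn: "winding_number (h \<circ> (\<delta> +++ \<eta>)) (h (pathstart (\<gamma> e))) = 1"
          "winding_number (h \<circ> (\<delta> +++ \<eta>)) (h (pathfinish (\<gamma> e))) = 0"
        using spec[OF cross, of e] unfolding crosses_positively_def by blast
      let ?d = "h \<circ> \<delta>" and ?\<eta> = "h \<circ> \<eta>"
      have rS: "tail D e \<subseteq> S2 - ?Dr" "head D e \<subseteq> S2 - ?Dr"
        using tails[of e] in_components_subset unfolding regions_def by blast+
      have "{0..1} = {0..<t} \<union> {t} \<union> {t<..1}" using t by auto
      then have \<delta>img: "path_image \<delta> = \<delta> ` {0..<t} \<union> {\<delta> t} \<union> \<delta> ` {t<..1}"
        unfolding path_image_def by (simp only: image_Un image_insert image_empty)
      have \<delta>Dr: "path_image \<delta> \<inter> ?Dr \<subseteq> \<gamma> e ` {0<..<1}"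
        unfolding \<delta>img using \<delta>t rS by blast
      have d_img: "path_image ?d = h ` path_image \<delta>" "path_image ?\<eta> = h ` path_image \<eta>"
        by (rule path_image_compose)+
      have d_path: "path ?d" "path ?\<eta>"
        using \<delta> \<eta>(1,2) by (auto intro!: path_continuous_image intro: continuous_on_subset[OF conth])
      have "W (pathfinish ?d) - W (pathstart ?d) = c e"
        unfolding W_def
      proof (rule winding_potential_jump[OF g_path g_ends c d_path(1)])
        fix x assume "x \<noteq> e"
        then have "path_image (\<gamma> x) \<inter> \<gamma> e ` {0<..<1} = {}"
          unfolding img using int_int[of x e] int_pos[of e] by blast
        then have "path_image (\<gamma> x) \<inter> path_image \<delta> = {}" using \<delta>Dr \<gamma>_Dr[of x] by blast
        moreover have "path_image (g x) \<inter> path_image ?d = h ` (path_image (\<gamma> x) \<inter> path_image \<delta>)"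
          unfolding g_img d_img by (rule hInt) (use \<gamma>_Dr Dr \<delta>(2) in blast)+
        ultimately show "path_image (g x) \<inter> path_image ?d = {}" by simp
      next
        have nP: "P v \<notin> path_image ?d" for v
        proof
          assume "P v \<in> path_image ?d"
          then obtain x where x: "x \<in> path_image \<delta>" "h (pos v) = h x" unfolding d_img P_def by blast
          have v: "pos v \<in> ?Dr" using pos_Dr by blast
          then have "pos v = x" using x \<delta>(2) Dr by (intro inj_onD[OF inj_h x(2)]) blast+
          then have "pos v \<in> \<gamma> e ` {0<..<1}" using \<delta>Dr x(1) v by blast
          then show False using int_pos[of e] by blast
        qed
        show "P (?t e) \<notin> path_image ?d" "P (?h e) \<notin> path_image ?d" by (rule nP)+
        show "path ?\<eta>" by (rule d_path(2))
        have "path_image ?\<eta> \<inter> path_image (g e) = h ` (path_image \<eta> \<inter> path_image (\<gamma> e))"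
          unfolding g_img d_img by (rule hInt) (use \<gamma>_Dr Dr \<eta>(2) in blast)+
        then show "path_image ?\<eta> \<inter> path_image (g e) = {}" using \<eta>(2) by auto
        show "pathstart ?\<eta> = pathfinish ?d" "pathfinish ?\<eta> = pathstart ?d"
          using \<eta>(3,4) by (simp_all add: pathstart_def pathfinish_def)
        show "winding_number (?d +++ ?\<eta>) (P (?t e)) = 1" "winding_number (?d +++ ?\<eta>) (P (?h e)) = 0"
          using wn unfolding start fin P_def path_compose_join by simp_all
      qed
      moreover have "pathstart \<delta> \<in> tail D e - {p}" "pathfinish \<delta> \<in> head D e - {p}"
        using \<delta>t t \<delta>(2) pathstart_in_path_image[of \<delta>] pathfinish_in_path_image[of \<delta>]
        unfolding pathstart_def pathfinish_def by force+
      moreover have "pathstart ?d = h (pathstart \<delta>)" "pathfinish ?d = h (pathfinish \<delta>)"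
        by (simp_all add: pathstart_def pathfinish_def)
      ultimately show ?thesis using Ww tails[of e] by metis
    qed
    then show "\<exists>w. \<forall>e. w (head D e) - w (tail D e) = c e" by blast
  qed
qed

theorem theorem10p1:
  fixes G :: "('a::finite, 'b::finite, 'e::finite) bigraph"
    and pos :: "'a + 'b \<Rightarrow> real ^ 3"
    and \<gamma> :: "'e \<Rightarrow> real \<Rightarrow> real ^ 3"
    and D :: "((real ^ 3) set, 'e) pre_digraph"
  assumes "sphere_embedding G pos \<gamma>"
    and "Digraph_Component.connected (graph_of G)"
    and "directed_planar_dual pos \<gamma> D"
  shows "arborescence_number D = card {f. hypertree G (end0 G) f}
    \<and> arborescence_number D = card {f. hypertree G (end1 G) f}
    \<and> arborescence_number D = card (hypertree_polytope G (end0 G) \<inter> integer_points)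
    \<and> arborescence_number D = card (hypertree_polytope G (end1 G) \<inter> integer_points)"
proof -
  interpret B: bipartite_dual "end0 G" "end1 G" "regions pos \<gamma>" "tail D" "head D"
    by (rule sphere_embedding_bipartite_dual[OF assms])
  \<comment> \<open>The swapped instance has the same regions and dual arcs, so hypertrees of both
    kinds are compared with one set of arborescences.\<close>
  interpret B': bipartite_dual "end1 G" "end0 G" "regions pos \<gamma>" "tail D" "head D"
    by (rule B.swap)
  have D: "verts D = regions pos \<gamma>" "arcs D = UNIV"
    using assms(3) unfolding directed_planar_dual_def by auto
  have tree: "is_spanning_tree (graph_of G) T \<longleftrightarrow> bip_tree (end0 G) (end1 G) T" for T
    by (subst is_spanning_tree_iff) (auto simp: graph_of_def)
  have H0: "{f. hypertree G (end0 G) f} = B.degree_vectors"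
    unfolding hypertree_def tree B.degree_vectors_def ..
  have H1: "{f. hypertree G (end1 G) f} = B'.degree_vectors"
    unfolding hypertree_def tree cut_tree_Inl_Inr_swap[of "end1 G" "end0 G", symmetric] B'.degree_vectors_def ..
  have arb: "{A. is_spanning_arborescence D r A} =
      {A. B.dual_tree A \<and> rooted_at (regions pos \<gamma>) (tail D) (head D) r A}" if "r \<in> regions pos \<gamma>" for r
    using is_spanning_arborescence_iff[of D r] B.range_dt B.range_dh that unfolding D by simp
  have card0: "card {A. is_spanning_arborescence D r A} = card {f. hypertree G (end0 G) f}"
    if "r \<in> regions pos \<gamma>" for r
    unfolding arb[OF that] H0 by (rule B.card_rooted_dual_trees[OF that])
  have card1: "card {A. is_spanning_arborescence D r A} = card {f. hypertree G (end1 G) f}"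
    if "r \<in> regions pos \<gamma>" for r
    unfolding arb[OF that] H1 by (rule B'.card_rooted_dual_trees[OF that])
  \<comment> \<open>Without a root every number would satisfy the description in
    \<open>arborescence_number\<close>.\<close>
  obtain r where r: "r \<in> regions pos \<gamma>" using B.R_ne by blast
  have 0: "arborescence_number D = card {f. hypertree G (end0 G) f}"
    unfolding arborescence_number_def D using card0 r by (intro the_equality) metis+
  moreover have "arborescence_number D = card {f. hypertree G (end1 G) f}"
    using 0 card0[OF r] card1[OF r] by simp
  moreover have "card (hypertree_polytope G (end0 G) \<inter> integer_points) = card {f. hypertree G (end0 G) f}"
    using card_integer_points_degree_vectors[of "end0 G" "end1 G"]
    unfolding hypertree_polytope_def hypertree_def tree by simp
  moreover have "card (hypertree_polytope G (end1 G) \<inter> integer_points) = card {f. hypertree G (end1 G) f}"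
    using card_integer_points_degree_vectors[of "end1 G" "end0 G"]
    unfolding hypertree_polytope_def hypertree_def tree cut_tree_Inl_Inr_swap[of "end1 G" "end0 G"] by simp
  ultimately show ?thesis by simp
qed

end
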